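(* Let $G$ be a finite simple connected graph. Then $G$ is complete intersection if and only if for every subset $H\subseteq V(G)$ the induced subgraph $G_H$ is complete intersection.
   Context: For a finite simple graph $G$ with vertices $v_1,\dots,v_n$ and edges $e_1,\dots,e_m$, and a field $K$, the toric ideal $I_G\subseteq K[e_1,\dots,e_m]$ is the kernel of the $K$-algebra homomorphism $K[e_1,\dots,e_m]\to K[v_1,\dots,v_n]$ sending $e_i=\{v_j,v_k\}$ to $v_jv_k$; it is generated by binomials. The graph $G$ is called complete intersection if $I_G$ is generated by $\operatorname{ht}(I_G)$ elements (for connected $G$, $\operatorname{ht}(I_G)=m-n+1$ if $G$ is bipartite and $m-n$ otherwise). For $H\subseteq V(G)$, the induced subgraph $G_H$ has vertex set $H$ and all edges of $G$ with both endpoints in $H$. *)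

theory Defs
  imports "HOL-Algebra.Ideal" "HOL-Library.Poly_Mapping" "HOL-Library.Extended_Nat"
begin

definition simple_graph :: "'v set \<Rightarrow> 'v set set \<Rightarrow> bool" where
  "simple_graph V E \<longleftrightarrow> finite V \<and> (\<forall>e\<in>E. e \<subseteq> V \<and> card e = 2)"

definition adjacent :: "'v set set \<Rightarrow> 'v \<Rightarrow> 'v \<Rightarrow> bool" where
  "adjacent E u w \<longleftrightarrow> {u, w} \<in> E"

definition connected_graph :: "'v set \<Rightarrow> 'v set set \<Rightarrow> bool" where
  "connected_graph V E \<longleftrightarrow> V \<noteq> {} \<and> (\<forall>u\<in>V. \<forall>w\<in>V. (adjacent E)\<^sup>*\<^sup>* u w)"

definition induced_edges :: "'v set set \<Rightarrow> 'v set \<Rightarrow> 'v set set" where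
  "induced_edges E H = {e \<in> E. e \<subseteq> H}"

text \<open>Polynomials over a field K in the variables X: finitely supported maps from
  monomials (finitely supported exponent vectors) to coefficients, all of whose
  monomials only involve variables from X.\<close>

definition poly_ring :: "'x set \<Rightarrow> (('x \<Rightarrow>\<^sub>0 nat) \<Rightarrow>\<^sub>0 'k::field) ring" where
  "poly_ring X = \<lparr>carrier = {p. \<forall>m\<in>Poly_Mapping.keys p. Poly_Mapping.keys m \<subseteq> X},
                   monoid.mult = (*), one = 1, zero = 0, add = (+)\<rparr>"

text \<open>The image of the monomial \<Prod> e^(m e) under e = {v_j,v_k} \<mapsto> v_j v_k.\<close>

definition edge_monomial_image :: "('v set \<Rightarrow>\<^sub>0 nat) \<Rightarrow> ('v \<Rightarrow>\<^sub>0 nat)" where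
  "edge_monomial_image m =
     (\<Sum>e\<in>Poly_Mapping.keys m. \<Sum>v\<in>e. Poly_Mapping.single v (Poly_Mapping.lookup m e))"

text \<open>The K-algebra homomorphism K[E] \<rightarrow> K[V] sending each edge to the product of its
  endpoints.\<close>

definition toric_map :: "(('v set \<Rightarrow>\<^sub>0 nat) \<Rightarrow>\<^sub>0 'k::field) \<Rightarrow> (('v \<Rightarrow>\<^sub>0 nat) \<Rightarrow>\<^sub>0 'k)" where
  "toric_map p =
     (\<Sum>m\<in>Poly_Mapping.keys p. Poly_Mapping.single (edge_monomial_image m) (Poly_Mapping.lookup p m))"

definition toric_ideal :: "'v set set \<Rightarrow> (('v set \<Rightarrow>\<^sub>0 nat) \<Rightarrow>\<^sub>0 'k::field) set" where
  "toric_ideal E = {p \<in> carrier (poly_ring E). toric_map p = 0}"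

definition prime_height :: "('a, 'b) ring_scheme \<Rightarrow> 'a set \<Rightarrow> enat" where
  "prime_height R P = Sup {enat n | n. \<exists>c :: nat \<Rightarrow> 'a set.
       (\<forall>i\<le>n. primeideal (c i) R) \<and> (\<forall>i<n. c i \<subset> c (Suc i)) \<and> c n = P}"

definition ideal_height :: "('a, 'b) ring_scheme \<Rightarrow> 'a set \<Rightarrow> enat" where
  "ideal_height R I = Inf {prime_height R P | P. primeideal P R \<and> I \<subseteq> P}"

definition complete_intersection :: "'k::field itself \<Rightarrow> 'v set \<Rightarrow> 'v set set \<Rightarrow> bool" where
  "complete_intersection TYPE('k) V E \<longleftrightarrow>
     (\<exists>fs :: (('v set \<Rightarrow>\<^sub>0 nat) \<Rightarrow>\<^sub>0 'k) list.
        enat (length fs) = ideal_height (poly_ring E :: (_ \<Rightarrow>\<^sub>0 'k) ring) (toric_ideal E) \<and>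
        set fs \<subseteq> carrier (poly_ring E :: (_ \<Rightarrow>\<^sub>0 'k) ring) \<and>
        genideal (poly_ring E :: (_ \<Rightarrow>\<^sub>0 'k) ring) (set fs) = toric_ideal E)"

end

theory Submission
  imports Defs
begin

text \<open>Write the toric ideal as the span of the binomials \<open>x^u - x^v\<close> with equal image, and let
  \<open>r\<close> be the rank of the lattice spanned by the vectors \<open>u - v\<close>. The height of the toric ideal is
  \<open>r\<close>: a flag of saturated sublattices gives a chain of \<open>r\<close> lattice primes below it, and no
  chain is longer, because each strict inclusion of primes lowers the growth exponent of the
  Hilbert function by at least one. If the ideal has \<open>r\<close> generators, graded Nakayama yields at most
  \<open>r\<close> binomial generators; their vectors span the lattice, so they are linearly independent.
  Setting the edges outside \<open>H\<close> to zero, the binomials supported on \<open>G_H\<close> generate its toric ideal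
  and still have independent vectors, so their number is the rank for \<open>G_H\<close>.\<close>

text \<open>Exponent vectors are taken over the rationals, so a sublattice is replaced by the
  rational subspace it spans. Membership in such a subspace is automatically saturated, and the
  quotient has no torsion; its group ring over any field is a domain, which makes the ideals of the
  flag prime in every characteristic. Quotients are never formed: a linear map with the prescribed
  kernel, or independence modulo an ideal, takes their place. The two height bounds are asymmetric.
  Height is an infimum over all primes above the ideal, so the flag must fit below an arbitrary such
  prime, while the upper bound may use the toric ideal itself, which is prime. The growth estimate
  starts from at least \<open>card E - r\<close> edges whose monomials stay independent modulo the
  toric ideal. Binomial generators are what makes the restriction to \<open>H\<close> countable: a
  subfamily of independent vectors is independent, so the surviving generators cannot outnumber the
  rank for \<open>H\<close>, and since they generate they cannot be fewer.\<close>

abbreviation keys where "keys \<equiv> Poly_Mapping.keys"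
abbreviation lookup where "lookup \<equiv> Poly_Mapping.lookup"
abbreviation single where "single \<equiv> Poly_Mapping.single"

section \<open>Finitely supported functions as a vector space\<close>

definition pscale :: "'k::field \<Rightarrow> ('a \<Rightarrow>\<^sub>0 'k) \<Rightarrow> ('a \<Rightarrow>\<^sub>0 'k)" where
  "pscale c p = Poly_Mapping.map ((*) c) p"

lemma lookup_pscale [simp]: "lookup (pscale c p) m = c * lookup p m"
  by (simp add: pscale_def Poly_Mapping.map.rep_eq when_def)

interpretation pm: vector_space "pscale :: 'k::field \<Rightarrow> ('a \<Rightarrow>\<^sub>0 'k) \<Rightarrow> ('a \<Rightarrow>\<^sub>0 'k)"
  by unfold_locales (auto intro!: poly_mapping_eqI simp: lookup_add algebra_simps)

interpretation pmp: vector_space_pair "pscale :: 'k::field \<Rightarrow> ('a \<Rightarrow>\<^sub>0 'k) \<Rightarrow> ('a \<Rightarrow>\<^sub>0 'k)"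
    "pscale :: 'k::field \<Rightarrow> ('b \<Rightarrow>\<^sub>0 'k) \<Rightarrow> ('b \<Rightarrow>\<^sub>0 'k)" ..

lemma pscale_single [simp]: "pscale c (single m d) = single m (c * d)"
  by (rule poly_mapping_eqI) (simp add: lookup_single when_def)

lemma pscale_eq_mult: "pscale c p = single 0 c * p"
  by (simp add: pscale_def mult_map_scale_conv_mult)

lemma mult_pscale_right:
  fixes p q :: "('a::comm_monoid_add) \<Rightarrow>\<^sub>0 'k::field"
  shows "p * pscale c q = pscale c (p * q)"
  by (simp add: pscale_eq_mult mult.left_commute)

lemma keys_pscale_subset: "keys (pscale c p) \<subseteq> keys p"
  by (auto simp: in_keys_iff)

lemma keys_diff_subset: "keys (p - q) \<subseteq> keys p \<union> keys (q :: 'a \<Rightarrow>\<^sub>0 'k::ab_group_add)"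
  by (auto simp: in_keys_iff lookup_minus)

lemma sum_single_lookup: "(\<Sum>m\<in>keys p. single m (lookup p m)) = p"
  by (rule poly_mapping_eqI)
     (auto simp: lookup_sum lookup_single when_def in_keys_iff)

lemma in_span_singles:
  assumes "keys p \<subseteq> M"
  shows "p \<in> pm.span ((\<lambda>m. single m 1) ` M)"
proof -
  have "(\<Sum>m\<in>keys p. pscale (lookup p m) (single m 1)) \<in> pm.span ((\<lambda>m. single m 1) ` M)"
    by (intro pm.span_sum pm.span_scale pm.span_base imageI) (use assms in blast)
  then show ?thesis by (simp add: sum_single_lookup)
qed

lemma subspace_keys_subset: "pm.subspace {p :: 'a \<Rightarrow>\<^sub>0 'b::field. keys p \<subseteq> M}"
proof (rule pm.subspaceI)
  fix p q :: "'a \<Rightarrow>\<^sub>0 'b" assume "p \<in> {p. keys p \<subseteq> M}" "q \<in> {p. keys p \<subseteq> M}"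
  then show "p + q \<in> {p. keys p \<subseteq> M}" using keys_add[of p q] by auto
next
  fix c and p :: "'a \<Rightarrow>\<^sub>0 'b" assume "p \<in> {p. keys p \<subseteq> M}"
  then show "pscale c p \<in> {p. keys p \<subseteq> M}" using keys_pscale_subset[of c p] by auto
qed simp

text \<open>A projection along the span of \<open>B\<close>: on a basis extending \<open>D\<close>
  it kills \<open>B\<close> and fixes everything else. It serves as the quotient map by the span of
  \<open>B\<close>; the last property says that the span of \<open>D - B\<close> embeds into that
  quotient.\<close>

lemma exists_linear_kernel:
  fixes D :: "('a \<Rightarrow>\<^sub>0 'k::field) set"
  assumes "pm.independent D" and "B \<subseteq> D"
  obtains T where "Vector_Spaces.linear pscale pscale T" "\<And>x. T x = 0 \<longleftrightarrow> x \<in> pm.span B"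
    "\<And>x. x \<in> pm.span (D - B) \<Longrightarrow> T x = x"
proof -
  define D' where "D' = pm.extend_basis D"
  have D': "pm.independent D'" "D \<subseteq> D'" "pm.span D' = UNIV"
    using pm.extend_basis_superset[OF assms(1)] pm.independent_extend_basis[OF assms(1)]
      pm.span_extend_basis[OF assms(1)] by (auto simp: D'_def)
  obtain T where T: "Vector_Spaces.linear pscale pscale T" "\<And>x. x \<in> D' \<Longrightarrow> T x = (if x \<in> B then 0 else x)"
    using pmp.linear_independent_extend[OF D'(1), of "\<lambda>x. if x \<in> B then 0 else x"] by auto
  interpret T: Vector_Spaces.linear pscale pscale T by (rule T(1))
  have zero: "T x = 0" if "x \<in> pm.span B" for x
    using that by (rule T.eq_0_on_span[rotated]) (use T(2) assms(2) D'(2) in auto)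
  have id: "T x = x" if "x \<in> pm.span (D - B)" for x
    using that by (rule pmp.linear_eq_on[OF T(1) pm.module_hom_ident]) (use T(2) D'(2) in auto)
  have diff: "x - T x \<in> pm.span B" for x
  proof -
    have "x \<in> pm.span D'" using D'(3) by simp
    thus ?thesis
    proof (induction rule: pm.span_induct_alt)
      case base show ?case by (simp add: pm.span_zero)
    next
      case (step c x y)
      have "x - T x \<in> pm.span B" using step(1) T(2) by (auto intro: pm.span_base pm.span_zero)
      moreover have "pscale c x + y - T (pscale c x + y) = pscale c (x - T x) + (y - T y)"
        by (simp add: T.add T.scale pm.scale_right_diff_distrib)
      ultimately show ?case using step(2) by (simp only: pm.span_add pm.span_scale)
    qed
  qed
  have "x \<in> pm.span B" if "T x = 0" for x using diff[of x] that by simp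
  with zero id T(1) that show thesis by blast
qed

lemma exists_linear_kernel_span:
  fixes S :: "('a \<Rightarrow>\<^sub>0 'k::field) set"
  obtains T :: "('a \<Rightarrow>\<^sub>0 'k) \<Rightarrow> ('a \<Rightarrow>\<^sub>0 'k)"
    where "Vector_Spaces.linear pscale pscale T" "\<And>x. T x = 0 \<longleftrightarrow> x \<in> pm.span S"
proof -
  obtain B where B: "B \<subseteq> S" "pm.independent B" "S \<subseteq> pm.span B"
    using pm.maximal_independent_subset by blast
  have "pm.span B = pm.span S" using B by (simp add: pm.span_eq pm.span_superset subset_trans)
  thus thesis using exists_linear_kernel[OF B(2) subset_refl] that by metis
qed

lemma relative_spanning_subset:
  fixes F M S :: "('a \<Rightarrow>\<^sub>0 'k::field) set"
  assumes "finite F" "S \<subseteq> pm.span (F \<union> M)"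
  obtains B where "B \<subseteq> S" "finite B" "card B \<le> card F" "S \<subseteq> pm.span (B \<union> M)"
proof -
  obtain T :: "('a \<Rightarrow>\<^sub>0 'k) \<Rightarrow> ('a \<Rightarrow>\<^sub>0 'k)"
    where T: "Vector_Spaces.linear pscale pscale T" "\<And>x. T x = 0 \<longleftrightarrow> x \<in> pm.span M"
    by (rule exists_linear_kernel_span[of M]) (rule that)
  interpret T: Vector_Spaces.linear pscale pscale T by (rule T(1))
  have "T ` S \<subseteq> pm.span (T ` (F \<union> M))"
    unfolding T.span_image using assms(2) by (rule image_mono)
  also have "\<dots> \<subseteq> pm.span (T ` F)"
  proof (rule pm.span_minimal)
    show "T ` (F \<union> M) \<subseteq> pm.span (T ` F)"
      using T(2)[THEN iffD2, OF pm.span_base]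
      by (auto simp: image_Un pm.span_base pm.span_zero)
  qed auto
  finally have TS: "T ` S \<subseteq> pm.span (T ` F)" .
  obtain C where C: "C \<subseteq> T ` S" "pm.independent C" "T ` S \<subseteq> pm.span C"
    using pm.maximal_independent_subset by blast
  have fC: "finite C \<and> card C \<le> card (T ` F)"
    using C TS assms(1) by (intro pm.independent_span_bound) auto
  obtain B where B: "B \<subseteq> S" "inj_on T B" "C = T ` B"
    using C(1) by (auto simp: subset_image_inj)
  have "S \<subseteq> pm.span (B \<union> M)"
  proof
    fix x assume "x \<in> S"
    then have "T x \<in> T ` pm.span B" using C(3) unfolding B(3) T.span_image by auto
    then obtain y where y: "y \<in> pm.span B" "T x = T y" by blast
    then have "x - y \<in> pm.span M" using T(2)[of "x - y"] by (simp add: T.diff)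
    with y(1) show "x \<in> pm.span (B \<union> M)"
      unfolding pm.span_Un mem_Collect_eq by (intro exI[of _ y] exI[of _ "x - y"]) simp
  qed
  moreover have "finite B" using fC B finite_image_iff by blast
  moreover have "card B \<le> card F"
    using fC B card_image[of T B] card_image_le[OF assms(1), of T] by simp
  ultimately show thesis using B(1) that by blast
qed

text \<open>A maximal independent subset of \<open>B\<close> still spans \<open>C\<close>, so it has
  at least \<open>card C\<close> elements and hence is all of \<open>B\<close>.\<close>

lemma independent_of_card_le_dim:
  fixes B C :: "('a \<Rightarrow>\<^sub>0 'k::field) set"
  assumes "finite B" "pm.independent C" "C \<subseteq> pm.span B" "card B \<le> card C"
  shows "pm.independent B"
proof -
  obtain B' where B': "B' \<subseteq> B" "pm.independent B'" "B \<subseteq> pm.span B'"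
    using pm.maximal_independent_subset by blast
  have "finite B'" using B' assms(1) finite_subset by blast
  moreover have "C \<subseteq> pm.span B'"
    using assms(3) B'(3) pm.span_minimal[of B "pm.span B'"] by auto
  ultimately have "card C \<le> card B'" using pm.independent_span_bound assms(2) by blast
  then have "B' = B" using B'(1) assms card_seteq by (metis le_trans)
  thus ?thesis using B' by simp
qed

section \<open>Linear extension of maps of monomials\<close>

text \<open>\<open>toric_map\<close> is the case of \<open>edge_monomial_image\<close>. The general
  form also admits rational exponent vectors as targets, where the codomain is a group ring.\<close>

definition push :: "('a \<Rightarrow> 'b) \<Rightarrow> ('a \<Rightarrow>\<^sub>0 'k::field) \<Rightarrow> ('b \<Rightarrow>\<^sub>0 'k)" where
  "push \<phi> p = (\<Sum>m\<in>keys p. single (\<phi> m) (lookup p m))"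

lemma push_superset:
  "finite S \<Longrightarrow> keys p \<subseteq> S \<Longrightarrow> push \<phi> p = (\<Sum>m\<in>S. single (\<phi> m) (lookup p m))"
  unfolding push_def by (rule sum.mono_neutral_left) (auto simp: in_keys_iff)

lemma push_single [simp]: "push \<phi> (single m c) = single (\<phi> m) c"
  by (subst push_superset[of "{m}"]) auto

lemma push_add: "push \<phi> (p + q) = push \<phi> p + push \<phi> q"
proof -
  have *: "finite (keys p \<union> keys q)" by simp
  show ?thesis
    using keys_add[of p q]
    by (simp add: push_superset[OF *] lookup_add single_add sum.distrib)
qed

lemma push_pscale: "push \<phi> (pscale c p) = pscale c (push \<phi> p)"
  by (simp add: push_superset[OF finite_keys keys_pscale_subset] push_def[of _ p] pm.scale_sum_right)

interpretation push: Vector_Spaces.linear "pscale :: 'k::field \<Rightarrow> ('a \<Rightarrow>\<^sub>0 'k) \<Rightarrow> _"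
    "pscale :: 'k::field \<Rightarrow> ('b \<Rightarrow>\<^sub>0 'k) \<Rightarrow> _" "push \<phi>" for \<phi>
  by unfold_locales (simp_all add: push_add push_pscale)

lemma push_comp: "push \<psi> (push \<phi> p) = push (\<lambda>m. \<psi> (\<phi> m)) p"
  by (simp add: push_def[of \<phi>] push_def[of "\<lambda>m. \<psi> (\<phi> m)"] push.sum)

lemma push_mult:
  fixes p q :: "('a::comm_monoid_add) \<Rightarrow>\<^sub>0 'k::field" and \<phi> :: "'a \<Rightarrow> 'b::comm_monoid_add"
  assumes "\<And>u v. \<phi> (u + v) = \<phi> u + \<phi> v"
  shows "push \<phi> (p * q) = push \<phi> p * push \<phi> q"
proof -
  have "p * q = (\<Sum>m\<in>keys p. \<Sum>n\<in>keys q. single (m + n) (lookup p m * lookup q n))"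
    by (simp add: sum_single_lookup flip: mult_single sum_product)
  then have "push \<phi> (p * q) =
      (\<Sum>m\<in>keys p. \<Sum>n\<in>keys q. single (\<phi> m) (lookup p m) * single (\<phi> n) (lookup q n))"
    by (simp add: push.sum assms mult_single)
  also have "\<dots> = push \<phi> p * push \<phi> q"
    by (simp add: push_def sum_product)
  finally show ?thesis .
qed

lemma lookup_push_inj_on:
  assumes "inj_on \<phi> S" "keys p \<subseteq> S" "m \<in> S"
  shows "lookup (push \<phi> p) (\<phi> m) = lookup p m"
proof -
  have "lookup (push \<phi> p) (\<phi> m) = (\<Sum>n\<in>keys p. if n = m then lookup p n else 0)"
    unfolding push_def lookup_sum
    by (rule sum.cong) (use assms in \<open>auto simp: lookup_single when_def inj_on_def\<close>)
  then show ?thesis by (simp add: in_keys_iff)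
qed

lemma push_eq_0_inj_on:
  assumes "inj_on \<phi> (keys p)" "push \<phi> p = 0"
  shows "p = 0"
  using lookup_push_inj_on[OF assms(1) order_refl] assms(2)
  by (metis in_keys_iff lookup_zero poly_mapping_eqI)

text \<open>Leading terms exist once the exponent group is totally ordered, but the index type
  \<open>'e\<close> carries no order. Only finitely many coordinates occur in \<open>p\<close> and
  \<open>q\<close>, so they are renamed to natural numbers, where exponent vectors are ordered
  lexicographically.\<close>

lemma group_ring_no_zero_divisors:
  fixes p q :: "('e \<Rightarrow>\<^sub>0 rat) \<Rightarrow>\<^sub>0 'k::field"
  assumes "p * q = 0"
  shows "p = 0 \<or> q = 0"
proof -
  define F where "F = (\<Union>m\<in>keys p \<union> keys q. keys m)"
  have "finite F" by (simp add: F_def)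
  then obtain i :: "'e \<Rightarrow> nat" where i: "inj_on i F"
    by (auto dest: finite_imp_inj_to_nat_seg)
  have inj: "inj_on (push i) M" if "M \<subseteq> {m. keys m \<subseteq> F}" for M :: "('e \<Rightarrow>\<^sub>0 rat) set"
  proof (rule inj_onI)
    fix x y :: "'e \<Rightarrow>\<^sub>0 rat" assume xy: "x \<in> M" "y \<in> M" "push i x = push i y"
    then have "keys (x - y) \<subseteq> F" using that keys_diff_subset[of x y] by auto
    then have "inj_on i (keys (x - y))" using i inj_on_subset by blast
    moreover have "push i (x - y) = 0" using xy(3) by (simp add: push.diff)
    ultimately have "x - y = 0" by (rule push_eq_0_inj_on)
    then show "x = y" by simp
  qed
  \<comment> \<open>The inner \<open>push i\<close> renames the coordinates of an exponent vector,
    the outer one applies this renaming to the monomials of a polynomial.\<close>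
  have "push (push i) p * push (push i) q = 0"
    using push_mult[of "push i" p q] assms by (simp add: push_add)
  then have "push (push i) p = 0 \<or> push (push i) q = 0" by simp
  moreover have "inj_on (push i) (keys p)" "inj_on (push i) (keys q)"
    by (rule inj, force simp: F_def)+
  ultimately show ?thesis using push_eq_0_inj_on by metis
qed

section \<open>Binomials and the kernels of maps of monomials\<close>

definition binom :: "'m \<Rightarrow> 'm \<Rightarrow> ('m \<Rightarrow>\<^sub>0 'k::field)" where
  "binom u v = single u 1 - single v 1"

lemma push_binom_eq_0_iff [simp]: "push \<phi> (binom u v :: 'm \<Rightarrow>\<^sub>0 'k::field) = 0 \<longleftrightarrow> \<phi> u = \<phi> v"
proof
  assume "push \<phi> (binom u v :: 'm \<Rightarrow>\<^sub>0 'k) = 0"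
  then have "lookup (push \<phi> (binom u v :: 'm \<Rightarrow>\<^sub>0 'k)) (\<phi> u) = 0" by simp
  then show "\<phi> u = \<phi> v"
    by (simp add: binom_def push.diff lookup_minus lookup_single when_def split: if_splits)
qed (simp add: binom_def push.diff)

lemma keys_binom_subset: "keys (binom u v) \<subseteq> {u, v}"
  unfolding binom_def using keys_diff_subset[of "single u 1" "single v 1"] by auto

lemma single_mult_binom: "single w 1 * binom u v = binom (w + u) (w + v)"
  by (simp add: binom_def algebra_simps mult_single)

text \<open>Replace every monomial of \<open>p\<close> by a chosen representative
  \<open>\<rho>\<close> of its fibre. The result factors through \<open>push \<phi> p = 0\<close>,
  hence vanishes, and its difference from \<open>p\<close> is visibly a combination of binomials
  within fibres.\<close>

lemma push_kernel_eq_span: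
  fixes M :: "'m set"
  shows "{p. keys p \<subseteq> M \<and> push \<phi> p = 0} =
    pm.span {binom u v :: 'm \<Rightarrow>\<^sub>0 'k::field | u v. u \<in> M \<and> v \<in> M \<and> \<phi> u = \<phi> v}"
    (is "?L = pm.span ?B")
proof
  have "pm.subspace ({p. keys p \<subseteq> M} \<inter> {p. push \<phi> p = 0})"
    by (intro pm.subspace_inter subspace_keys_subset push.subspace_kernel)
  then have sub: "pm.subspace ?L" by (simp add: Collect_conj_eq)
  show "pm.span ?B \<subseteq> ?L"
  proof (rule pm.span_minimal[OF _ sub])
    show "?B \<subseteq> ?L" using keys_binom_subset by fastforce
  qed
  show "?L \<subseteq> pm.span ?B"
  proof
    fix p :: "'m \<Rightarrow>\<^sub>0 'k" assume p: "p \<in> ?L"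
    define \<rho> where "\<rho> a = (SOME m. m \<in> M \<and> \<phi> m = a)" for a
    have \<rho>: "\<rho> (\<phi> m) \<in> M \<and> \<phi> (\<rho> (\<phi> m)) = \<phi> m" if "m \<in> M" for m
      unfolding \<rho>_def using that by (rule_tac someI_ex) auto
    have "push (\<lambda>m. \<rho> (\<phi> m)) p = 0"
      using p push_comp[of \<rho> \<phi> p] by simp
    then have "p = p - push (\<lambda>m. \<rho> (\<phi> m)) p" by simp
    also have "\<dots> = (\<Sum>m\<in>keys p. pscale (lookup p m) (binom m (\<rho> (\<phi> m))))"
      by (simp add: push_def binom_def pm.scale_right_diff_distrib sum_subtractf sum_single_lookup)
    also have "\<dots> \<in> pm.span ?B"
      using p \<rho> by (intro pm.span_sum pm.span_scale pm.span_base) force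
    finally show "p \<in> pm.span ?B" .
  qed
qed

section \<open>Ideals of the polynomial ring\<close>

definition monomials :: "'e set \<Rightarrow> ('e \<Rightarrow>\<^sub>0 nat) set" where
  "monomials E = {m. keys m \<subseteq> E}"

lemma zero_in_monomials [simp]: "0 \<in> monomials E"
  by (simp add: monomials_def)

lemma add_in_monomials_iff [simp]: "u + v \<in> monomials E \<longleftrightarrow> u \<in> monomials E \<and> v \<in> monomials E"
  by (auto simp: monomials_def subset_iff in_keys_iff lookup_add)

lemma poly_ring_simps [simp]:
  "p \<otimes>\<^bsub>poly_ring E\<^esub> q = p * q" "p \<oplus>\<^bsub>poly_ring E\<^esub> q = p + q"
  "\<zero>\<^bsub>poly_ring E\<^esub> = 0" "\<one>\<^bsub>poly_ring E\<^esub> = 1"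
  by (simp_all add: poly_ring_def)

lemma carrier_poly_ring: "carrier (poly_ring E) = {p. keys p \<subseteq> monomials E}"
  by (auto simp: poly_ring_def monomials_def)

lemma carrier_poly_ring_add:
  "p \<in> carrier (poly_ring E) \<Longrightarrow> q \<in> carrier (poly_ring E) \<Longrightarrow> p + q \<in> carrier (poly_ring E)"
  using keys_add[of p q] by (auto simp: carrier_poly_ring)

lemma carrier_poly_ring_mult:
  "p \<in> carrier (poly_ring E) \<Longrightarrow> q \<in> carrier (poly_ring E) \<Longrightarrow> p * q \<in> carrier (poly_ring E)"
  using keys_mult[of p q] by (fastforce simp: carrier_poly_ring)

lemma single_in_carrier: "m \<in> monomials E \<Longrightarrow> single m c \<in> carrier (poly_ring E)"
  by (auto simp: carrier_poly_ring)

lemma subspace_carrier: "pm.subspace (carrier (poly_ring E))"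
  unfolding carrier_poly_ring by (rule subspace_keys_subset)

lemma cring_poly_ring: "cring (poly_ring E :: (('e \<Rightarrow>\<^sub>0 nat) \<Rightarrow>\<^sub>0 'k::field) ring)"
proof (rule cringI)
  let ?R = "poly_ring E :: (('e \<Rightarrow>\<^sub>0 nat) \<Rightarrow>\<^sub>0 'k) ring"
  show "abelian_group ?R"
  proof (rule abelian_groupI)
    fix p assume "p \<in> carrier ?R"
    then have "- p \<in> carrier ?R" by (rule pm.subspace_neg[OF subspace_carrier])
    then show "\<exists>q\<in>carrier ?R. q \<oplus>\<^bsub>?R\<^esub> p = \<zero>\<^bsub>?R\<^esub>" by (intro bexI[of _ "- p"]) auto
  next
    show "\<zero>\<^bsub>?R\<^esub> \<in> carrier ?R" by (simp add: carrier_poly_ring)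
  qed (simp_all add: add_ac carrier_poly_ring_add)
  show "Group.comm_monoid ?R"
  proof (rule comm_monoidI)
    show "\<one>\<^bsub>?R\<^esub> \<in> carrier ?R" by (simp add: carrier_poly_ring)
  qed (simp_all add: mult_ac carrier_poly_ring_mult)
qed (simp add: algebra_simps)

lemma ideal_poly_ringI:
  fixes I :: "(('e \<Rightarrow>\<^sub>0 nat) \<Rightarrow>\<^sub>0 'k::field) set"
  assumes "pm.subspace I" "I \<subseteq> carrier (poly_ring E)"
    and "\<And>p q. p \<in> carrier (poly_ring E) \<Longrightarrow> q \<in> I \<Longrightarrow> p * q \<in> I"
  shows "ideal I (poly_ring E)"
proof -
  let ?R = "poly_ring E :: (('e \<Rightarrow>\<^sub>0 nat) \<Rightarrow>\<^sub>0 'k) ring"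
  interpret R: cring ?R by (rule cring_poly_ring)
  have neg: "\<ominus>\<^bsub>?R\<^esub> p = - p" if "p \<in> I" for p
    using that assms(2) pm.subspace_neg[OF subspace_carrier, of p E]
    by (intro R.minus_equality) auto
  show ?thesis
  proof (rule idealI)
    show "ring ?R" by (rule R.ring_axioms)
    show "subgroup I (add_monoid ?R)"
    proof (rule subgroup.intro)
      fix p assume "p \<in> I"
      then show "inv\<^bsub>add_monoid ?R\<^esub> p \<in> I"
        using neg pm.subspace_neg[OF assms(1)] unfolding a_inv_def by simp
    qed (use assms(2) pm.subspace_add[OF assms(1)] pm.subspace_0[OF assms(1)] in auto)
    fix p q assume "p \<in> I" "q \<in> carrier ?R"
    then have "q * p \<in> I" by (rule assms(3)[rotated])
    then show "q \<otimes>\<^bsub>?R\<^esub> p \<in> I" "p \<otimes>\<^bsub>?R\<^esub> q \<in> I" by (simp_all add: mult.commute)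
  qed
qed

lemma subspace_ideal:
  fixes I :: "(('e \<Rightarrow>\<^sub>0 nat) \<Rightarrow>\<^sub>0 'k::field) set"
  assumes "ideal I (poly_ring E)"
  shows "pm.subspace I"
proof -
  interpret ideal I "poly_ring E" by (rule assms)
  show ?thesis
  proof (rule pm.subspaceI)
    show "0 \<in> I" using additive_subgroup.zero_closed[OF is_additive_subgroup] by simp
    show "p + q \<in> I" if "p \<in> I" "q \<in> I" for p q using additive_subgroup.a_closed[OF is_additive_subgroup that] by simp
    show "pscale c p \<in> I" if "p \<in> I" for c p
      using I_l_closed[OF that single_in_carrier[of 0 E c]] by (simp add: pscale_eq_mult)
  qed
qed

text \<open>The linear span of these products is the ideal generated by \<open>S\<close>, so
  generation becomes a question about spans and linear maps can be applied to it.\<close>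

definition monomial_multiples ::
  "'e set \<Rightarrow> (('e \<Rightarrow>\<^sub>0 nat) \<Rightarrow>\<^sub>0 'k::field) set \<Rightarrow> (('e \<Rightarrow>\<^sub>0 nat) \<Rightarrow>\<^sub>0 'k) set" where
  "monomial_multiples E S = {single u 1 * s | u s. u \<in> monomials E \<and> s \<in> S}"

lemma mult_in_span_monomial_multiples:
  fixes p q :: "('e \<Rightarrow>\<^sub>0 nat) \<Rightarrow>\<^sub>0 'k::field"
  assumes "p \<in> carrier (poly_ring E)" "q \<in> pm.span (monomial_multiples E S)"
  shows "p * q \<in> pm.span (monomial_multiples E S)"
proof -
  have single: "single m c * q \<in> pm.span (monomial_multiples E S)" if m: "m \<in> monomials E" for m c
    using assms(2)
  proof (induction rule: pm.span_induct_alt)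
    case base then show ?case by (simp add: pm.span_zero)
  next
    case (step d x y)
    obtain u s where x: "x = single u 1 * s" "u \<in> monomials E" "s \<in> S"
      using step(1) by (auto simp: monomial_multiples_def)
    have "single m c * pscale d x = pscale (c * d) (single (m + u) 1 * s)"
      by (simp add: x pscale_eq_mult mult_ac mult_single flip: mult.assoc)
    moreover have "single (m + u) 1 * s \<in> monomial_multiples E S"
      unfolding monomial_multiples_def using x m add_in_monomials_iff by blast
    ultimately show ?case using step(2)
      by (simp add: distrib_left pm.span_add pm.span_scale pm.span_base)
  qed
  have "(\<Sum>m\<in>keys p. single m (lookup p m) * q) \<in> pm.span (monomial_multiples E S)"
    using assms(1) by (intro pm.span_sum single) (auto simp: carrier_poly_ring)
  then show ?thesis by (simp add: sum_single_lookup flip: sum_distrib_right)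
qed

lemma genideal_eq_span:
  fixes S :: "(('e \<Rightarrow>\<^sub>0 nat) \<Rightarrow>\<^sub>0 'k::field) set"
  assumes "S \<subseteq> carrier (poly_ring E)"
  shows "genideal (poly_ring E) S = pm.span (monomial_multiples E S)"
proof
  have "ideal (pm.span (monomial_multiples E S)) (poly_ring E)"
  proof (rule ideal_poly_ringI)
    show "pm.span (monomial_multiples E S) \<subseteq> carrier (poly_ring E)"
      using assms
      by (intro pm.span_minimal subspace_carrier)
         (auto simp: monomial_multiples_def intro!: carrier_poly_ring_mult single_in_carrier)
  qed (auto intro: mult_in_span_monomial_multiples)
  moreover have "S \<subseteq> pm.span (monomial_multiples E S)"
  proof
    fix s assume "s \<in> S"
    then have "single 0 1 * s \<in> monomial_multiples E S"
      unfolding monomial_multiples_def using zero_in_monomials by blast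
    then show "s \<in> pm.span (monomial_multiples E S)" using pm.span_base by fastforce
  qed
  ultimately show "genideal (poly_ring E) S \<subseteq> pm.span (monomial_multiples E S)"
    by (auto simp: genideal_def)
  show "pm.span (monomial_multiples E S) \<subseteq> genideal (poly_ring E) S"
    unfolding genideal_def
  proof (intro Inter_greatest)
    fix I assume "I \<in> {I. ideal I (poly_ring E) \<and> S \<subseteq> I}"
    then have I: "ideal I (poly_ring E)" "S \<subseteq> I" by auto
    have "monomial_multiples E S \<subseteq> I"
      using I ideal.I_l_closed[OF I(1)] single_in_carrier
      by (fastforce simp: monomial_multiples_def)
    then show "pm.span (monomial_multiples E S) \<subseteq> I"
      by (rule pm.span_minimal) (rule subspace_ideal[OF I(1)])
  qed
qed

text \<open>An additive map of exponents induces a ring homomorphism, and the kernel of a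
  homomorphism into a domain is prime. Rational exponents exclude torsion in the target, which would
  create zero divisors such as the factors of \<open>x^n - 1\<close>.\<close>

lemma primeideal_push_kernel:
  fixes \<psi> :: "('e \<Rightarrow>\<^sub>0 nat) \<Rightarrow> ('f \<Rightarrow>\<^sub>0 rat)"
  assumes add: "\<And>u v. \<psi> (u + v) = \<psi> u + \<psi> v"
  shows "primeideal {p :: ('e \<Rightarrow>\<^sub>0 nat) \<Rightarrow>\<^sub>0 'k::field. keys p \<subseteq> monomials E \<and> push \<psi> p = 0} (poly_ring E)"
    (is "primeideal ?I ?R")
proof -
  have I: "?I = {p \<in> carrier ?R. push \<psi> p = 0}" by (simp add: carrier_poly_ring)
  have "pm.subspace (carrier ?R \<inter> {p. push \<psi> p = 0})"
    by (intro pm.subspace_inter subspace_carrier push.subspace_kernel)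
  then have sub: "pm.subspace ?I" by (simp add: I Collect_conj_eq)
  show ?thesis
  proof (rule primeidealI)
    show "ideal ?I ?R"
      by (rule ideal_poly_ringI[OF sub]) (auto simp: I push_mult[OF add] carrier_poly_ring_mult)
    show "cring ?R" by (rule cring_poly_ring)
    have "push \<psi> (single 0 1 :: _ \<Rightarrow>\<^sub>0 'k) \<noteq> 0"
      by (metis lookup_single_eq lookup_zero push_single zero_neq_one)
    then have "single 0 1 \<notin> ?I" by blast
    then show "carrier ?R \<noteq> ?I" using single_in_carrier[OF zero_in_monomials] by blast
    fix p q assume "p \<in> carrier ?R" "q \<in> carrier ?R" "p \<otimes>\<^bsub>?R\<^esub> q \<in> ?I"
    then show "p \<in> ?I \<or> q \<in> ?I"
      using group_ring_no_zero_divisors[of "push \<psi> p" "push \<psi> q"] by (auto simp: I push_mult[OF add])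
  qed
qed

section \<open>Chains of primes and Hilbert functions\<close>

definition tdeg :: "('e \<Rightarrow>\<^sub>0 nat) \<Rightarrow> nat" where
  "tdeg m = (\<Sum>e\<in>keys m. lookup m e)"

lemma tdeg_superset: "finite S \<Longrightarrow> keys m \<subseteq> S \<Longrightarrow> tdeg m = (\<Sum>e\<in>S. lookup m e)"
  unfolding tdeg_def by (rule sum.mono_neutral_left) (auto simp: in_keys_iff)

lemma tdeg_add: "tdeg (u + v) = tdeg u + tdeg v"
proof -
  have *: "finite (keys u \<union> keys v)" by simp
  show ?thesis
    using keys_add[of u v] by (simp add: tdeg_superset[OF *] lookup_add sum.distrib)
qed

lemma lookup_le_tdeg: "lookup m e \<le> tdeg m"
  by (cases "e \<in> keys m") (auto simp: tdeg_def in_keys_iff intro: member_le_sum)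

lemma tdeg_eq_0_iff [simp]: "tdeg m = 0 \<longleftrightarrow> m = 0"
  by (auto simp: tdeg_def) (metis in_keys_iff lookup_zero poly_mapping_eqI)

definition bounded_polys :: "'e set \<Rightarrow> nat \<Rightarrow> (('e \<Rightarrow>\<^sub>0 nat) \<Rightarrow>\<^sub>0 'k::field) set" where
  "bounded_polys E d = {p. keys p \<subseteq> {m \<in> monomials E. tdeg m \<le> d}}"

lemma bounded_polys_subset_carrier: "bounded_polys E d \<subseteq> carrier (poly_ring E)"
  by (auto simp: bounded_polys_def carrier_poly_ring)

lemma bounded_polys_mono: "d \<le> d' \<Longrightarrow> bounded_polys E d \<subseteq> bounded_polys E d'"
  by (fastforce simp: bounded_polys_def)

lemma bounded_polys_mult:
  "p \<in> bounded_polys E d \<Longrightarrow> q \<in> bounded_polys E d' \<Longrightarrow> p * q \<in> bounded_polys E (d + d')"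
  using keys_mult[of p q] by (fastforce simp: bounded_polys_def tdeg_add intro: add_mono)

lemma carrier_poly_ring_bounded:
  assumes "p \<in> carrier (poly_ring E)"
  obtains d where "p \<in> bounded_polys E d"
proof
  show "p \<in> bounded_polys E (\<Sum>m\<in>keys p. tdeg m)"
    using assms by (auto simp: bounded_polys_def carrier_poly_ring intro!: member_le_sum)
qed

text \<open>\<open>hilbert_ge E P d k\<close> says that the space of polynomials of degree at most \<open>d\<close> modulo
  \<open>P\<close> has dimension at least \<open>k\<close>.\<close>

definition hilbert_ge :: "'e set \<Rightarrow> (('e \<Rightarrow>\<^sub>0 nat) \<Rightarrow>\<^sub>0 'k::field) set \<Rightarrow> nat \<Rightarrow> nat \<Rightarrow> bool" where
  "hilbert_ge E P d k \<longleftrightarrow> (\<exists>g :: nat \<Rightarrow> _. (\<forall>i<k. g i \<in> bounded_polys E d) \<and>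
     (\<forall>c. (\<Sum>i<k. pscale (c i) (g i)) \<in> P \<longrightarrow> (\<forall>i<k. c i = 0)))"

lemma hilbert_ge_mono: "hilbert_ge E P d k \<Longrightarrow> d \<le> d' \<Longrightarrow> hilbert_ge E P d' k"
  unfolding hilbert_ge_def using bounded_polys_mono by blast

lemma sum_lessThan_add:
  fixes f :: "nat \<Rightarrow> 'a::comm_monoid_add"
  shows "(\<Sum>i<k + l. f i) = (\<Sum>i<k. f i) + (\<Sum>i<l. f (k + i))"
  by (induction l) (simp_all add: add.assoc)

text \<open>Multiplication by \<open>f\<close> is injective modulo the prime \<open>P\<close> and lands in \<open>Q\<close>.\<close>

lemma hilbert_ge_add:
  fixes P Q :: "(('e \<Rightarrow>\<^sub>0 nat) \<Rightarrow>\<^sub>0 'k::field) set"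
  assumes P: "primeideal P (poly_ring E)" and Q: "ideal Q (poly_ring E)" and "P \<subseteq> Q"
    and f: "f \<in> Q" "f \<notin> P" "f \<in> bounded_polys E e"
    and "hilbert_ge E P d k" "hilbert_ge E Q (d + e) l"
  shows "hilbert_ge E P (d + e) (k + l)"
proof -
  interpret P: primeideal P "poly_ring E" by (rule P)
  obtain g where g: "\<And>i. i < k \<Longrightarrow> g i \<in> bounded_polys E d"
      "\<And>c. (\<Sum>i<k. pscale (c i) (g i)) \<in> P \<Longrightarrow> (\<forall>i<k. c i = 0)"
    using assms(7) unfolding hilbert_ge_def by blast
  obtain h where h: "\<And>i. i < l \<Longrightarrow> h i \<in> bounded_polys E (d + e)"
      "\<And>c. (\<Sum>i<l. pscale (c i) (h i)) \<in> Q \<Longrightarrow> (\<forall>i<l. c i = 0)"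
    using assms(8) unfolding hilbert_ge_def by blast
  define gh where "gh i = (if i < k then f * g i else h (i - k))" for i
  have fC: "f \<in> carrier (poly_ring E)" using f(3) bounded_polys_subset_carrier by blast
  have gC: "(\<Sum>i<k. pscale (c i) (g i)) \<in> carrier (poly_ring E)" for c
    using g(1) bounded_polys_subset_carrier
    by (intro pm.subspace_sum[OF subspace_carrier] pm.subspace_scale[OF subspace_carrier]) blast
  have "\<forall>i<k + l. c i = 0" if c: "(\<Sum>i<k + l. pscale (c i) (gh i)) \<in> P" for c
  proof -
    let ?G = "\<Sum>i<k. pscale (c i) (g i)" and ?H = "\<Sum>i<l. pscale (c (k + i)) (h i)"
    have split: "(\<Sum>i<k + l. pscale (c i) (gh i)) = f * ?G + ?H"
      by (simp add: sum_lessThan_add gh_def sum_distrib_left mult_pscale_right)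
    \<comment> \<open>The two groups of coefficients are separated in this order: modulo
      \<open>Q\<close> the multiples of \<open>f\<close> disappear, which forces the coefficients of
      \<open>h\<close> to vanish; then primality of \<open>P\<close> cancels \<open>f\<close> and
      leaves a relation among the \<open>g i\<close>.\<close>
    have "?G * f \<in> Q" using ideal.I_l_closed[OF Q f(1) gC[of c]] by simp
    moreover have "f * ?G + ?H \<in> Q" using c split assms(3) by auto
    ultimately have "?H \<in> Q"
      using pm.subspace_diff[OF subspace_ideal[OF Q], of "f * ?G + ?H" "?G * f"]
      by (simp add: mult.commute)
    then have H0: "\<forall>i<l. c (k + i) = 0" using h(2)[of "\<lambda>i. c (k + i)"] by blast
    then have "f * ?G \<in> P" using c split by simp
    then have "?G \<in> P" using P.I_prime[OF fC gC[of c]] f(2) by simp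
    then have "\<forall>i<k. c i = 0" using g(2)[of c] by blast
    with H0 show ?thesis by (metis add_diff_inverse_nat nat_add_left_cancel_less)
  qed
  moreover have "gh i \<in> bounded_polys E (d + e)" if "i < k + l" for i
    using that g(1)[of i] h(1)[of "i - k"] bounded_polys_mult[OF f(3), of "g i" d]
    by (auto simp: gh_def add.commute)
  ultimately show ?thesis unfolding hilbert_ge_def by blast
qed

text \<open>Each multiplication by a fixed \<open>f\<close> in \<open>Q\<close> outside
  \<open>P\<close> costs degree \<open>e\<close> and gains \<open>d ^ k\<close> further independent
  elements. Doing this \<open>d\<close> times gains a factor \<open>d\<close> while the degree stays
  linear in \<open>d\<close>, with new slope \<open>a + e\<close>.\<close>

lemma hilbert_ge_power_Suc:
  fixes P Q :: "(('e \<Rightarrow>\<^sub>0 nat) \<Rightarrow>\<^sub>0 'k::field) set"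
  assumes P: "primeideal P (poly_ring E)" and Q: "primeideal Q (poly_ring E)" and "P \<subset> Q"
    and Q_ge: "\<And>d. hilbert_ge E Q (a * d) (d ^ k)"
  obtains a' where "\<And>d. hilbert_ge E P (a' * d) (d ^ Suc k)"
proof -
  interpret Q: primeideal Q "poly_ring E" by (rule Q)
  obtain f where f: "f \<in> Q" "f \<notin> P" using \<open>P \<subset> Q\<close> by blast
  obtain e where e: "f \<in> bounded_polys E e"
    using carrier_poly_ring_bounded[of f E] f(1) Q.a_subset by blast
  have iter: "hilbert_ge E P (a * d + i * e) (i * d ^ k)" for d i
  proof (induction i)
    case 0 show ?case by (simp add: hilbert_ge_def)
  next
    case (Suc i)
    have "hilbert_ge E Q (a * d + i * e + e) (d ^ k)"
      by (rule hilbert_ge_mono[OF Q_ge[of d]]) simp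
    from hilbert_ge_add[OF P Q.ideal_axioms _ f e Suc this] \<open>P \<subset> Q\<close>
    show ?case by (simp add: algebra_simps)
  qed
  show thesis
  proof (rule that)
    fix d
    show "hilbert_ge E P ((a + e) * d) (d ^ Suc k)"
      using iter[of d d] by (simp add: algebra_simps)
  qed
qed

lemma hilbert_ge_prime_chain:
  fixes c :: "nat \<Rightarrow> (('e \<Rightarrow>\<^sub>0 nat) \<Rightarrow>\<^sub>0 'k::field) set"
  assumes "\<And>i. i \<le> n \<Longrightarrow> primeideal (c i) (poly_ring E)" "\<And>i. i < n \<Longrightarrow> c i \<subset> c (Suc i)"
    and "\<And>d. hilbert_ge E (c n) (a * d) (d ^ k)"
  obtains a' where "\<And>d. hilbert_ge E (c 0) (a' * d) (d ^ (k + n))"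
proof -
  \<comment> \<open>Here \<open>j\<close> counts the inclusions passed on the way down from the top
    of the chain, each adding one to the exponent.\<close>
  have "\<exists>a'. \<forall>d. hilbert_ge E (c (n - j)) (a' * d) (d ^ (k + j))" if "j \<le> n" for j
    using that
  proof (induction j)
    case 0 then show ?case using assms(3) by auto
  next
    case (Suc j)
    then obtain a' where a': "\<And>d. hilbert_ge E (c (n - j)) (a' * d) (d ^ (k + j))" by auto
    have "n - j = Suc (n - Suc j)" using Suc.prems by simp
    then have "c (n - Suc j) \<subset> c (n - j)" using assms(2)[of "n - Suc j"] Suc.prems by simp
    then obtain a'' where "\<And>d. hilbert_ge E (c (n - Suc j)) (a'' * d) (d ^ Suc (k + j))"
      using hilbert_ge_power_Suc[OF assms(1) assms(1) _ a', of "n - Suc j"] by auto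
    then show ?case by auto
  qed
  from this[of n] that show thesis by auto
qed

section \<open>Counting monomials and bounding the length of chains\<close>

lemma card_box:
  assumes "finite F"
  shows "finite {m :: 'e \<Rightarrow>\<^sub>0 nat. m \<in> monomials F \<and> (\<forall>e\<in>F. lookup m e < d)} \<and>
    card {m :: 'e \<Rightarrow>\<^sub>0 nat. m \<in> monomials F \<and> (\<forall>e\<in>F. lookup m e < d)} = d ^ card F"
    (is "finite ?B \<and> _")
proof -
  have bij: "bij_betw (\<lambda>m. restrict (lookup m) F) ?B (F \<rightarrow>\<^sub>E {..<d})"
  proof (rule bij_betwI')
    fix m n assume mn: "m \<in> ?B" "n \<in> ?B"
    show "(restrict (lookup m) F = restrict (lookup n) F) = (m = n)"
    proof
      assume eq: "restrict (lookup m) F = restrict (lookup n) F"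
      show "m = n"
      proof (rule poly_mapping_eqI)
        fix e show "lookup m e = lookup n e"
        proof (cases "e \<in> F")
          case True then show ?thesis using fun_cong[OF eq, of e] by simp
        next
          case False
          then have "e \<notin> keys m" "e \<notin> keys n" using mn by (auto simp: monomials_def)
          then show ?thesis by (simp add: in_keys_iff)
        qed
      qed
    qed simp
  next
    fix m assume "m \<in> ?B" then show "restrict (lookup m) F \<in> F \<rightarrow>\<^sub>E {..<d}" by auto
  next
    fix g assume g: "g \<in> F \<rightarrow>\<^sub>E {..<d}"
    define m where "m = Abs_poly_mapping (\<lambda>e. if e \<in> F then g e else 0)"
    have "lookup m = (\<lambda>e. if e \<in> F then g e else 0)"
      unfolding m_def by (rule lookup_Abs_poly_mapping) (use assms in simp)
    then have "m \<in> ?B" "g = restrict (lookup m) F"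
      using g by (auto simp: monomials_def in_keys_iff PiE_def extensional_def restrict_def split: if_splits)
    then show "\<exists>m\<in>?B. g = restrict (lookup m) F" by blast
  qed
  have "finite (F \<rightarrow>\<^sub>E {..<d})" "card (F \<rightarrow>\<^sub>E {..<d}) = d ^ card F"
    using assms by (simp_all add: finite_PiE card_PiE)
  then show ?thesis using bij_betw_finite[OF bij] bij_betw_same_card[OF bij] by simp
qed

lemma hilbert_ge_bound:
  fixes P :: "(('e \<Rightarrow>\<^sub>0 nat) \<Rightarrow>\<^sub>0 'k::field) set"
  assumes "finite E" "0 \<in> P" "hilbert_ge E P d k"
  shows "k \<le> (d + 1) ^ card E"
proof -
  obtain g where g': "\<And>i. i < k \<Longrightarrow> g i \<in> bounded_polys E d"
      "\<And>c. (\<Sum>i<k. pscale (c i) (g i)) \<in> P \<Longrightarrow> (\<forall>i<k. c i = 0)"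
    using assms(3) unfolding hilbert_ge_def by blast
  have g: "\<And>i. i < k \<Longrightarrow> g i \<in> bounded_polys E d"
      "\<And>c. (\<Sum>i<k. pscale (c i) (g i)) = 0 \<Longrightarrow> (\<forall>i<k. c i = 0)"
    using g' assms(2) by simp_all
  have inj: "inj_on g {..<k}"
  proof (rule inj_onI, rule ccontr)
    fix i j assume ij: "i \<in> {..<k}" "j \<in> {..<k}" "g i = g j" "i \<noteq> j"
    \<comment> \<open>A repetition in the family would be a nontrivial relation with coefficients
      \<open>1\<close> and \<open>-1\<close>.\<close>
    let ?c = "\<lambda>x. (if x = i then 1 else 0) - (if x = j then 1 else 0) :: 'k"
    have "(\<Sum>x<k. pscale (?c x) (g x)) =
        (\<Sum>x<k. if x = i then g x else 0) - (\<Sum>x<k. if x = j then g x else 0)"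
      unfolding sum_subtractf[symmetric]
      by (rule sum.cong) (auto simp: pm.scale_left_diff_distrib)
    also have "\<dots> = 0" using ij by simp
    finally have "\<forall>x<k. ?c x = 0" by (rule g(2))
    then have "?c i = 0" using ij(1) by blast
    then show False using ij(4) by simp
  qed
  have "pm.independent (g ` {..<k})"
  proof
    assume "pm.dependent (g ` {..<k})"
    then obtain u where u: "\<exists>v\<in>g ` {..<k}. u v \<noteq> 0" "(\<Sum>v\<in>g ` {..<k}. pscale (u v) v) = 0"
      by (auto simp: pm.dependent_finite)
    then have "(\<Sum>i<k. pscale (u (g i)) (g i)) = 0" by (simp add: sum.reindex[OF inj])
    then have "\<forall>i<k. u (g i) = 0" using g(2)[of "\<lambda>i. u (g i)"] by simp
    then show False using u(1) by auto
  qed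
  \<comment> \<open>A total degree of at most \<open>d\<close> bounds each exponent by
    \<open>d\<close>, so the monomials fit into a box of side \<open>d + 1\<close>. This overcounts,
    but with the right growth exponent \<open>card E\<close>.\<close>
  moreover define M where "M = {m \<in> monomials E. \<forall>e\<in>E. lookup m e < d + 1}"
  have "g ` {..<k} \<subseteq> pm.span ((\<lambda>m. single m 1) ` M)"
  proof
    fix p assume "p \<in> g ` {..<k}"
    then have p: "p \<in> bounded_polys E d" using g(1) by auto
    have "keys p \<subseteq> M"
    proof
      fix m assume "m \<in> keys p"
      then have "m \<in> monomials E" "tdeg m \<le> d" using p by (auto simp: bounded_polys_def)
      then show "m \<in> M"
        using order_trans[OF lookup_le_tdeg] by (auto simp: M_def less_Suc_eq_le)
    qed
    then show "p \<in> pm.span ((\<lambda>m. single m 1) ` M)" by (rule in_span_singles)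
  qed
  moreover have M: "finite M" "card M = (d + 1) ^ card E"
    using card_box[OF assms(1), of "d + 1"] by (simp_all add: M_def)
  ultimately have "card (g ` {..<k}) \<le> card ((\<lambda>m. single m (1::'k)) ` M)"
    using pm.independent_span_bound by blast
  also have "\<dots> \<le> (d + 1) ^ card E" using card_image_le[OF M(1)] M(2) by metis
  finally show ?thesis by (simp add: card_image[OF inj])
qed

text \<open>Two growth rates are compared: descending the chain yields \<open>d ^ (k + n)\<close>
  elements of degree linear in \<open>d\<close> that are independent modulo the lowest prime,
  whereas the whole ring grows only like \<open>d ^ card E\<close>.\<close>

lemma prime_chain_length_bound:
  fixes c :: "nat \<Rightarrow> (('e \<Rightarrow>\<^sub>0 nat) \<Rightarrow>\<^sub>0 'k::field) set"
  assumes "finite E"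
    and "\<And>i. i \<le> n \<Longrightarrow> primeideal (c i) (poly_ring E)" "\<And>i. i < n \<Longrightarrow> c i \<subset> c (Suc i)"
    and "\<And>d. hilbert_ge E (c n) (a * d) (d ^ k)"
  shows "k + n \<le> card E"
proof (rule ccontr)
  assume "\<not> k + n \<le> card E"
  then have less: "Suc (card E) \<le> k + n" by simp
  obtain a' where a': "\<And>d. hilbert_ge E (c 0) (a' * d) (d ^ (k + n))"
    using hilbert_ge_prime_chain[of n c E a k] assms(2-4) by auto
  \<comment> \<open>Any \<open>d\<close> above \<open>(a' + 1) ^ card E\<close> makes
    \<open>d * d ^ card E\<close> exceed the bound \<open>((a' + 1) * d) ^ card E\<close>.\<close>
  define d where "d = Suc ((a' + 1) ^ card E)"
  have d: "d \<ge> 1" by (simp add: d_def)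
  interpret primeideal "c 0" "poly_ring E" by (rule assms(2)) simp
  have "0 \<in> c 0" by (rule pm.subspace_0[OF subspace_ideal[OF ideal_axioms]])
  then have "d ^ (k + n) \<le> (a' * d + 1) ^ card E"
    using hilbert_ge_bound[OF assms(1)] a' by blast
  also have "\<dots> \<le> ((a' + 1) * d) ^ card E" using d by (intro power_mono) auto
  also have "\<dots> = (a' + 1) ^ card E * d ^ card E" by (rule power_mult_distrib)
  also have "\<dots> < d * d ^ card E"
    by (rule mult_strict_right_mono) (use d in \<open>simp_all add: d_def\<close>)
  also have "\<dots> \<le> d ^ (k + n)" using power_increasing[OF less d] by simp
  finally show False by simp
qed

section \<open>The relation lattice of a graph\<close>

text \<open>Rational rather than integer entries make differences of monomials elements of a vector
  space, where rank is dimension and saturation is automatic.\<close>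

definition vec :: "('e \<Rightarrow>\<^sub>0 nat) \<Rightarrow> ('e \<Rightarrow>\<^sub>0 rat)" where
  "vec m = Poly_Mapping.map of_nat m"

lemma lookup_vec [simp]: "lookup (vec m) e = of_nat (lookup m e)"
  by (simp add: vec_def Poly_Mapping.map.rep_eq when_def)

lemma keys_vec [simp]: "keys (vec m) = keys m"
  by (auto simp: in_keys_iff)

lemma vec_add: "vec (u + v) = vec u + vec v"
  by (rule poly_mapping_eqI) (simp add: lookup_add)

lemma vec_sum: "vec (sum f A) = (\<Sum>a\<in>A. vec (f a))"
  by (rule poly_mapping_eqI) (simp add: lookup_sum)

lemma vec_single: "vec (single e c) = single e (of_nat c)"
  by (rule poly_mapping_eqI) (simp add: lookup_single when_def)

lemma vec_eq_iff [simp]: "vec u = vec v \<longleftrightarrow> u = v"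
  by (metis lookup_vec of_nat_eq_iff poly_mapping_eqI)

text \<open>The unsigned vertex-edge incidence matrix acting on rational edge weights; it extends
  \<open>edge_monomial_image\<close> linearly to differences of exponent vectors.\<close>

definition incidence :: "('v set \<Rightarrow>\<^sub>0 rat) \<Rightarrow> ('v \<Rightarrow>\<^sub>0 rat)" where
  "incidence x = (\<Sum>e\<in>keys x. \<Sum>v\<in>e. single v (lookup x e))"

lemma incidence_superset:
  "finite S \<Longrightarrow> keys x \<subseteq> S \<Longrightarrow> incidence x = (\<Sum>e\<in>S. \<Sum>v\<in>e. single v (lookup x e))"
  unfolding incidence_def by (rule sum.mono_neutral_left) (auto simp: in_keys_iff)

lemma linear_incidence: "Vector_Spaces.linear pscale pscale (incidence :: ('v set \<Rightarrow>\<^sub>0 rat) \<Rightarrow> _)"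
proof unfold_locales
  fix x y :: "'v set \<Rightarrow>\<^sub>0 rat" and c
  have *: "finite (keys x \<union> keys y)" by simp
  show "incidence (x + y) = incidence x + incidence y"
    using keys_add[of x y]
    by (simp add: incidence_superset[OF *] lookup_add single_add sum.distrib)
  show "incidence (pscale c x) = pscale c (incidence x)"
    by (simp add: incidence_superset[OF finite_keys keys_pscale_subset] incidence_def[of x]
        pm.scale_sum_right)
qed

lemma vec_edge_monomial_image: "vec (edge_monomial_image m) = incidence (vec m)"
  by (simp add: edge_monomial_image_def incidence_def vec_sum vec_single)

lemma edge_monomial_image_add:
  "edge_monomial_image (u + v) = edge_monomial_image u + edge_monomial_image v"
proof -
  interpret inc: Vector_Spaces.linear pscale pscale incidence by (rule linear_incidence)
  have "vec (edge_monomial_image (u + v)) = vec (edge_monomial_image u + edge_monomial_image v)"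
    by (simp add: vec_edge_monomial_image vec_add inc.add)
  then show ?thesis by simp
qed

text \<open>Exponents are natural numbers, so no cancellation occurs. Finiteness of the edges
  matters because the sum over an infinite edge would be \<open>0\<close>. Two consequences are
  drawn from this: nontrivial monomials have images of positive degree, and the image reveals
  whether all edges lie in \<open>H\<close>.\<close>

lemma keys_edge_monomial_image:
  assumes "\<And>e. e \<in> keys m \<Longrightarrow> finite e"
  shows "keys (edge_monomial_image m) = \<Union>(keys m)"
proof -
  have "lookup (edge_monomial_image m) w = (\<Sum>e\<in>keys m. if w \<in> e then lookup m e else 0)" for w
    unfolding edge_monomial_image_def lookup_sum
    by (intro sum.cong refl) (use assms in \<open>auto simp: lookup_single when_def\<close>)
  then have "w \<in> keys (edge_monomial_image m) \<longleftrightarrow>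
      (\<exists>e\<in>keys m. (if w \<in> e then lookup m e else 0) \<noteq> 0)" for w
    by (simp add: in_keys_iff[of w])
  also have "\<dots> w \<longleftrightarrow> w \<in> \<Union>(keys m)" for w by (auto simp: in_keys_iff)
  finally show ?thesis by blast
qed

section \<open>Relations between edge monomials and their rational span\<close>

definition image_pairs :: "'v set set \<Rightarrow> (('v set \<Rightarrow>\<^sub>0 nat) \<times> ('v set \<Rightarrow>\<^sub>0 nat)) set" where
  "image_pairs E = {(u, v). u \<in> monomials E \<and> v \<in> monomials E \<and>
     edge_monomial_image u = edge_monomial_image v}"

abbreviation pair_binom :: "'m \<times> 'm \<Rightarrow> ('m \<Rightarrow>\<^sub>0 'k::field)" where
  "pair_binom \<equiv> \<lambda>(u, v). binom u v"

abbreviation pair_relation :: "('e \<Rightarrow>\<^sub>0 nat) \<times> ('e \<Rightarrow>\<^sub>0 nat) \<Rightarrow> ('e \<Rightarrow>\<^sub>0 rat)" where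
  "pair_relation \<equiv> \<lambda>(u, v). vec u - vec v"

lemma toric_ideal_eq_span: "toric_ideal E = pm.span (pair_binom ` image_pairs E)"
proof -
  have "toric_ideal E = {p. keys p \<subseteq> monomials E \<and> push edge_monomial_image p = 0}"
    by (simp add: toric_ideal_def toric_map_def push_def carrier_poly_ring)
  also have "\<dots> = pm.span (pair_binom ` image_pairs E)"
    unfolding push_kernel_eq_span
    by (rule arg_cong[where f = pm.span]) (force simp: image_pairs_def)
  finally show ?thesis .
qed

text \<open>Passing to the rational span creates no new relations between monomials: all relations
  lie in the kernel of \<open>incidence\<close>, hence so does their span.\<close>

lemma relation_span_iff:
  assumes "u \<in> monomials E" "v \<in> monomials E"
  shows "vec u - vec v \<in> pm.span (pair_relation ` image_pairs E) \<longleftrightarrow>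
    edge_monomial_image u = edge_monomial_image v"
proof
  interpret inc: Vector_Spaces.linear pscale pscale incidence by (rule linear_incidence)
  assume "vec u - vec v \<in> pm.span (pair_relation ` image_pairs E)"
  then have "incidence (vec u - vec v) = 0"
    by (rule inc.eq_0_on_span[rotated])
       (auto simp: image_pairs_def inc.diff simp flip: vec_edge_monomial_image)
  then show "edge_monomial_image u = edge_monomial_image v"
    by (simp add: inc.diff flip: vec_edge_monomial_image)
next
  assume "edge_monomial_image u = edge_monomial_image v"
  then have "(u, v) \<in> image_pairs E" using assms by (simp add: image_pairs_def)
  then show "vec u - vec v \<in> pm.span (pair_relation ` image_pairs E)"
    by (intro pm.span_base) force
qed

definition relation_rank :: "'v set set \<Rightarrow> nat" where
  "relation_rank E = pm.dim (pair_relation ` image_pairs E)"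

lemma relation_subset_span_units:
  "pair_relation ` image_pairs E \<subseteq> pm.span ((\<lambda>e. single e 1) ` E)"
proof
  fix x assume "x \<in> pair_relation ` image_pairs E"
  then obtain u v where uv: "x = vec u - vec v" "u \<in> monomials E" "v \<in> monomials E"
    by (auto simp: image_pairs_def)
  then show "x \<in> pm.span ((\<lambda>e. single e 1) ` E)"
    using keys_diff_subset[of "vec u" "vec v"] by (intro in_span_singles) (auto simp: monomials_def)
qed

lemma relation_basis:
  assumes "finite E"
  obtains B where "B \<subseteq> pair_relation ` image_pairs E" "pm.independent B" "finite B"
    "pm.span B = pm.span (pair_relation ` image_pairs E)" "card B = relation_rank E"
proof -
  obtain B where B: "B \<subseteq> pair_relation ` image_pairs E" "pm.independent B"
    "pair_relation ` image_pairs E \<subseteq> pm.span B" "card B = relation_rank E"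
    unfolding relation_rank_def by (rule pm.basis_exists)
  have "finite B"
    using pm.independent_span_bound[of "(\<lambda>e. single e 1) ` E" B] B(1,2) assms
      relation_subset_span_units[of E] by auto
  moreover have "pm.span B = pm.span (pair_relation ` image_pairs E)"
    using B(1,3) pm.span_superset[of "pair_relation ` image_pairs E"] by (simp add: pm.span_eq)
  ultimately show thesis using B that by blast
qed

text \<open>For a rational subspace \<open>L\<close> this is the lattice ideal of the saturated
  lattice of integer vectors in \<open>L\<close>. The toric ideal is the case of the full relation
  space; smaller subspaces supply the primes below it.\<close>

definition lattice_ideal :: "'e set \<Rightarrow> ('e \<Rightarrow>\<^sub>0 rat) set \<Rightarrow> (('e \<Rightarrow>\<^sub>0 nat) \<Rightarrow>\<^sub>0 'k::field) set" where
  "lattice_ideal E L =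
     pm.span {binom u v | u v. u \<in> monomials E \<and> v \<in> monomials E \<and> vec u - vec v \<in> L}"

lemma lattice_ideal_mono: "L \<subseteq> L' \<Longrightarrow> lattice_ideal E L \<subseteq> lattice_ideal E L'"
  unfolding lattice_ideal_def by (rule pm.span_mono) blast

lemma toric_ideal_eq_lattice_ideal:
  "(toric_ideal E :: (_ \<Rightarrow>\<^sub>0 'k::field) set) =
     lattice_ideal E (pm.span (pair_relation ` image_pairs E))"
proof -
  define L where "L = pm.span (pair_relation ` image_pairs E)"
  have "{binom u v :: _ \<Rightarrow>\<^sub>0 'k | u v. u \<in> monomials E \<and> v \<in> monomials E \<and> vec u - vec v \<in> L} =
      pair_binom ` image_pairs E"
    using relation_span_iff[of _ E, folded L_def] by (force simp: image_pairs_def)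
  then show ?thesis by (simp add: toric_ideal_eq_span lattice_ideal_def flip: L_def)
qed

text \<open>Composing \<open>vec\<close> with a linear map whose kernel is the span of
  \<open>L\<close> gives a map of monomials whose fibres are the classes modulo \<open>L\<close>, so
  the description of kernels by binomials applies.\<close>

lemma lattice_ideal_eq_push_kernel:
  fixes L :: "('e \<Rightarrow>\<^sub>0 rat) set"
  obtains \<psi> :: "('e \<Rightarrow>\<^sub>0 nat) \<Rightarrow> ('e \<Rightarrow>\<^sub>0 rat)"
  where "\<And>u v. \<psi> (u + v) = \<psi> u + \<psi> v" "\<And>u v. \<psi> u = \<psi> v \<longleftrightarrow> vec u - vec v \<in> pm.span L"
    "(lattice_ideal E (pm.span L) :: (('e \<Rightarrow>\<^sub>0 nat) \<Rightarrow>\<^sub>0 'k::field) set) =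
       {p. keys p \<subseteq> monomials E \<and> push \<psi> p = 0}"
proof -
  obtain T :: "('e \<Rightarrow>\<^sub>0 rat) \<Rightarrow> ('e \<Rightarrow>\<^sub>0 rat)"
    where T: "Vector_Spaces.linear pscale pscale T" "\<And>x. T x = 0 \<longleftrightarrow> x \<in> pm.span L"
    by (rule exists_linear_kernel_span[of L]) (rule that)
  interpret T: Vector_Spaces.linear pscale pscale T by (rule T(1))
  have iff: "T (vec u) = T (vec v) \<longleftrightarrow> vec u - vec v \<in> pm.span L" for u v
    by (simp flip: T(2) add: T.diff)
  show thesis
  proof (rule that[of "\<lambda>u. T (vec u)"])
    show "(lattice_ideal E (pm.span L) :: (('e \<Rightarrow>\<^sub>0 nat) \<Rightarrow>\<^sub>0 'k) set) =
        {p. keys p \<subseteq> monomials E \<and> push (\<lambda>u. T (vec u)) p = 0}"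
      unfolding lattice_ideal_def push_kernel_eq_span iff ..
  qed (simp_all add: iff vec_add T.add)
qed

lemma primeideal_lattice_ideal:
  fixes L :: "('e \<Rightarrow>\<^sub>0 rat) set"
  shows "primeideal (lattice_ideal E (pm.span L) :: (_ \<Rightarrow>\<^sub>0 'k::field) set) (poly_ring E)"
proof -
  obtain \<psi> :: "('e \<Rightarrow>\<^sub>0 nat) \<Rightarrow> ('e \<Rightarrow>\<^sub>0 rat)"
  where "\<And>u v. \<psi> (u + v) = \<psi> u + \<psi> v"
    "(lattice_ideal E (pm.span L) :: (('e \<Rightarrow>\<^sub>0 nat) \<Rightarrow>\<^sub>0 'k::field) set) =
       {p. keys p \<subseteq> monomials E \<and> push \<psi> p = 0}"
    by (rule lattice_ideal_eq_push_kernel[of L E]) (rule that)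
  then show ?thesis using primeideal_push_kernel[of \<psi> E] by simp
qed

text \<open>The bridge from ideals back to vectors: it proves the inclusions of the flag strict, and
  it turns generation by binomials into spanning by their exponent differences.\<close>

lemma binom_in_lattice_ideal_iff:
  assumes "u \<in> monomials E" "v \<in> monomials E"
  shows "(binom u v :: _ \<Rightarrow>\<^sub>0 'k::field) \<in> lattice_ideal E (pm.span L) \<longleftrightarrow> vec u - vec v \<in> pm.span L"
proof -
  obtain \<psi> :: "('a \<Rightarrow>\<^sub>0 nat) \<Rightarrow> ('a \<Rightarrow>\<^sub>0 rat)"
  where "\<And>u v. \<psi> u = \<psi> v \<longleftrightarrow> vec u - vec v \<in> pm.span L"
    "(lattice_ideal E (pm.span L) :: (('a \<Rightarrow>\<^sub>0 nat) \<Rightarrow>\<^sub>0 'k::field) set) =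
       {p. keys p \<subseteq> monomials E \<and> push \<psi> p = 0}"
    by (rule lattice_ideal_eq_push_kernel[of L E]) (rule that)
  then show ?thesis using keys_binom_subset[of u v] assms by auto
qed

lemma independent_singles:
  assumes "finite M"
  shows "pm.independent ((\<lambda>m. single m (1::'k::field)) ` M)"
proof
  have inj: "inj_on (\<lambda>m. single m (1::'k)) M"
    by (rule inj_onI) (metis lookup_single_eq lookup_single_not_eq zero_neq_one)
  assume "pm.dependent ((\<lambda>m. single m (1::'k)) ` M)"
  then obtain c where c: "\<exists>v\<in>(\<lambda>m. single m (1::'k)) ` M. c v \<noteq> 0"
      "(\<Sum>v\<in>(\<lambda>m. single m (1::'k)) ` M. pscale (c v) v) = 0"
    using assms by (auto simp: pm.dependent_finite)
  then obtain m where m: "m \<in> M" "c (single m 1) \<noteq> 0" by blast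
  have "(\<Sum>n\<in>M. single n (c (single n 1))) = 0"
    using c(2) by (simp add: sum.reindex[OF inj])
  then have "lookup (\<Sum>n\<in>M. single n (c (single n 1))) m = 0" by simp
  then show False using m assms by (simp add: lookup_sum lookup_single when_def)
qed

section \<open>The height of a toric ideal\<close>

text \<open>The flag is spanned by the prefixes of a basis. As the basis vectors are themselves
  differences \<open>vec u - vec v\<close>, each one comes with a binomial that separates
  consecutive ideals.\<close>

lemma relation_rank_le_prime_height:
  fixes P :: "(('v set \<Rightarrow>\<^sub>0 nat) \<Rightarrow>\<^sub>0 'k::field) set"
  assumes "finite E" "primeideal P (poly_ring E)" "toric_ideal E \<subseteq> P"
  shows "enat (relation_rank E) \<le> prime_height (poly_ring E) P"
proof -
  let ?R = "poly_ring E :: (('v set \<Rightarrow>\<^sub>0 nat) \<Rightarrow>\<^sub>0 'k) ring" and ?r = "relation_rank E"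
  obtain B where B: "B \<subseteq> pair_relation ` image_pairs E" "pm.independent B" "finite B"
    "pm.span B = pm.span (pair_relation ` image_pairs E)" "card B = ?r"
    by (rule relation_basis[OF assms(1)])
  obtain bs where bs: "set bs = B" "distinct bs" using finite_distinct_list[OF B(3)] by blast
  have len: "length bs = ?r" using bs B(5) distinct_card by metis
  define c :: "nat \<Rightarrow> (('v set \<Rightarrow>\<^sub>0 nat) \<Rightarrow>\<^sub>0 'k) set"
    where "c i = lattice_ideal E (pm.span (set (take i bs)))" for i
  have prime: "primeideal (c i) ?R" for i
    unfolding c_def by (rule primeideal_lattice_ideal)
  have strict: "c i \<subset> c (Suc i)" if i: "i < ?r" for i
  proof
    have take: "set (take (Suc i) bs) = insert (bs ! i) (set (take i bs))"
      using i len by (simp add: take_Suc_conv_app_nth)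
    then have "set (take i bs) \<subseteq> set (take (Suc i) bs)" by blast
    then show "c i \<subseteq> c (Suc i)" unfolding c_def by (intro lattice_ideal_mono pm.span_mono)
    have "bs ! i \<in> B" using bs(1) i len nth_mem by metis
    then obtain u v where uv: "bs ! i = vec u - vec v" "u \<in> monomials E" "v \<in> monomials E"
      using B(1) by (fastforce simp: image_pairs_def)
    have "set (take i bs) \<subseteq> B - {bs ! i}"
      using bs i len set_take_subset[of i bs] by (auto simp: in_set_conv_nth nth_eq_iff_index_eq)
    then have "bs ! i \<notin> pm.span (set (take i bs))"
      using B(2) \<open>bs ! i \<in> B\<close> pm.span_mono unfolding pm.dependent_def by blast
    then have "binom u v \<notin> c i" "binom u v \<in> c (Suc i)"
      unfolding c_def binom_in_lattice_ideal_iff[OF uv(2,3)] uv(1)[symmetric] take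
      by (simp_all add: pm.span_base)
    then show "c i \<noteq> c (Suc i)" by blast
  qed
  have top: "c ?r = toric_ideal E"
    using len bs(1) B(4) by (simp add: c_def toric_ideal_eq_lattice_ideal)
  show ?thesis
  proof (cases "P = toric_ideal E")
    case True
    then show ?thesis
      unfolding prime_height_def
      by (intro Sup_upper CollectI exI[of _ ?r] exI[of _ c]) (use prime strict top in auto)
  next
    case False
    \<comment> \<open>A prime strictly above the toric ideal is appended on top of the flag, which
      makes the chain one step longer.\<close>
    define c' where "c' i = (if i \<le> ?r then c i else P)" for i
    have "enat ?r \<le> enat (Suc ?r)" by simp
    also have "\<dots> \<le> prime_height ?R P"
      unfolding prime_height_def
    proof (intro Sup_upper CollectI exI[of _ "Suc ?r"] exI[of _ c'] conjI allI impI)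
      fix i assume "i < Suc ?r"
      then show "c' i \<subset> c' (Suc i)"
        using strict[of i] top False assms(3) by (cases "i = ?r") (auto simp: c'_def)
    qed (use prime assms(2) in \<open>auto simp: c'_def\<close>)
    finally show ?thesis .
  qed
qed

text \<open>Extend a basis \<open>B\<close> of the relation space by unit vectors of edges to a
  basis of the whole edge space; \<open>F\<close> collects the added edges. Two monomials in
  \<open>F\<close> with equal image differ by a vector in both the span of \<open>D - B\<close> and
  the span of \<open>B\<close>, hence by zero.\<close>

lemma independent_edges:
  assumes "finite E"
  obtains F where "F \<subseteq> E" "card E \<le> card F + relation_rank E"
    "inj_on edge_monomial_image (monomials F)"
proof -
  let ?s = "\<lambda>e. single e 1 :: 'a set \<Rightarrow>\<^sub>0 rat"
  have inj: "inj_on ?s A" for A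
    by (rule inj_onI) (metis lookup_single_eq lookup_single_not_eq zero_neq_one)
  obtain B where B: "B \<subseteq> pair_relation ` image_pairs E" "pm.independent B" "finite B"
    "pm.span B = pm.span (pair_relation ` image_pairs E)" "card B = relation_rank E"
    by (rule relation_basis[OF assms])
  obtain D where D: "B \<subseteq> D" "D \<subseteq> B \<union> ?s ` E" "pm.independent D" "B \<union> ?s ` E \<subseteq> pm.span D"
    using pm.maximal_independent_subset_extend[of B "B \<union> ?s ` E"] B(2) by auto
  have finD: "finite D" using D(2) B(3) assms finite_subset by blast
  have "card (?s ` E) \<le> card D"
    using pm.independent_span_bound[OF finD independent_singles[OF assms]] D(4) by blast
  then have cardD: "card E \<le> card D" by (simp add: card_image[OF inj])
  define F where "F = {e \<in> E. ?s e \<in> D - B}"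
  have F: "?s ` F = D - B" using D(2) by (auto simp: F_def)
  have "card F = card D - relation_rank E"
    using card_image[OF inj, of F] card_Diff_subset[OF B(3) D(1)] by (simp add: F B(5))
  then have "card E \<le> card F + relation_rank E" using cardD by simp
  moreover have "inj_on edge_monomial_image (monomials F)"
  proof (rule inj_onI)
    fix u v assume uv: "u \<in> monomials F" "v \<in> monomials F"
      "edge_monomial_image u = edge_monomial_image v"
    obtain T where T: "\<And>x. T x = 0 \<longleftrightarrow> x \<in> pm.span B" "\<And>x. x \<in> pm.span (D - B) \<Longrightarrow> T x = x"
      by (rule exists_linear_kernel[OF D(3) D(1)]) (rule that)
    have "keys (vec u - vec v) \<subseteq> F"
      using uv(1,2) keys_diff_subset[of "vec u" "vec v"] by (auto simp: monomials_def)
    then have "vec u - vec v \<in> pm.span (D - B)" unfolding F[symmetric] by (rule in_span_singles)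
    moreover have "u \<in> monomials E" "v \<in> monomials E"
      using uv(1,2) by (auto simp: monomials_def F_def)
    then have "vec u - vec v \<in> pm.span B" unfolding B(4) using uv(3) by (simp add: relation_span_iff)
    ultimately have "vec u - vec v = 0" using T(1)[of "vec u - vec v"] T(2)[of "vec u - vec v"] by simp
    then show "u = v" by simp
  qed
  ultimately show thesis using that[of F] by (simp add: F_def)
qed

text \<open>The witnesses are the \<open>d ^ card F\<close> monomials in \<open>F\<close> with all
  exponents below \<open>d\<close>. Their images are distinct monomials, so no nontrivial
  combination lies in the toric ideal.\<close>

lemma hilbert_ge_toric_ideal:
  assumes "F \<subseteq> E" "finite E" "inj_on edge_monomial_image (monomials F)"
  shows "hilbert_ge E (toric_ideal E :: (_ \<Rightarrow>\<^sub>0 'k::field) set) (card F * d) (d ^ card F)"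
proof -
  have finF: "finite F" using assms finite_subset by blast
  define M where "M = {m. m \<in> monomials F \<and> (\<forall>e\<in>F. lookup m e < d)}"
  have M: "finite M" "card M = d ^ card F" using card_box[OF finF, of d] by (simp_all add: M_def)
  obtain h where h: "bij_betw h {..<card M} M"
    using ex_bij_betw_nat_finite[OF M(1)] by (auto simp: atLeast0LessThan)
  have hM: "h i \<in> M" if "i < card M" for i using h that by (auto simp: bij_betw_def)
  have "single (h i) (1::'k) \<in> bounded_polys E (card F * d)" if "i < card M" for i
  proof -
    have "h i \<in> monomials F" "\<forall>e\<in>F. lookup (h i) e \<le> d" using hM[OF that] by (auto simp: M_def)
    moreover from this have "tdeg (h i) \<le> (\<Sum>e\<in>F. d)"
      using sum_mono[of F "lookup (h i)" "\<lambda>_. d"] tdeg_superset[OF finF, of "h i"]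
      by (simp add: monomials_def)
    ultimately show ?thesis using assms(1) by (auto simp: bounded_polys_def monomials_def)
  qed
  moreover have "\<forall>i<card M. c i = 0"
    if c: "(\<Sum>i<card M. pscale (c i) (single (h i) (1::'k))) \<in> toric_ideal E" for c
  proof (intro allI impI)
    fix j assume j: "j < card M"
    have inj: "inj_on (\<lambda>i. edge_monomial_image (h i)) {..<card M}"
    proof -
      have "inj_on edge_monomial_image (h ` {..<card M})"
        by (rule inj_on_subset[OF assms(3)]) (use hM in \<open>auto simp: M_def\<close>)
      with h show ?thesis
        using comp_inj_on[of h "{..<card M}" edge_monomial_image] by (simp add: bij_betw_def comp_def)
    qed
    let ?p = "\<Sum>i<card M. single (edge_monomial_image (h i)) (c i)"
    have "push edge_monomial_image (\<Sum>i<card M. pscale (c i) (single (h i) (1::'k))) = 0"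
      using c by (simp add: toric_ideal_def toric_map_def push_def)
    then have "?p = 0" by (simp add: push.sum)
    then have "lookup ?p (edge_monomial_image (h j)) = 0" by simp
    moreover have "lookup ?p (edge_monomial_image (h j)) = (\<Sum>i<card M. if i = j then c i else 0)"
      unfolding lookup_sum
      by (rule sum.cong) (use inj j in \<open>auto simp: lookup_single when_def inj_on_def\<close>)
    ultimately show "c j = 0" using j by simp
  qed
  ultimately show ?thesis
    unfolding hilbert_ge_def M(2)[symmetric]
    by (intro exI[of _ "\<lambda>i. single (h i) 1"] conjI allI impI) blast+
qed

lemma ideal_height_toric_ideal:
  assumes "finite E"
  shows "ideal_height (poly_ring E) (toric_ideal E :: (_ \<Rightarrow>\<^sub>0 'k::field) set) = enat (relation_rank E)"
proof (rule antisym)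
  let ?I = "toric_ideal E :: (_ \<Rightarrow>\<^sub>0 'k) set"
  have prime: "primeideal ?I (poly_ring E)"
    unfolding toric_ideal_eq_lattice_ideal by (rule primeideal_lattice_ideal)
  obtain F where F: "F \<subseteq> E" "card E \<le> card F + relation_rank E"
    "inj_on edge_monomial_image (monomials F)"
    by (rule independent_edges[OF assms])
  have "prime_height (poly_ring E) ?I \<le> enat (relation_rank E)"
    unfolding prime_height_def
  proof (rule Sup_least)
    fix x assume "x \<in> {enat n |n. \<exists>c. (\<forall>i\<le>n. primeideal (c i) (poly_ring E)) \<and>
        (\<forall>i<n. c i \<subset> c (Suc i)) \<and> c n = ?I}"
    then obtain n c where c: "x = enat n" "\<And>i. i \<le> n \<Longrightarrow> primeideal (c i) (poly_ring E)"
        "\<And>i. i < n \<Longrightarrow> c i \<subset> c (Suc i)" "c n = ?I"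
      by blast
    \<comment> \<open>Together with \<open>card E \<le> card F + relation_rank E\<close>, the size
      of \<open>F\<close> cancels and leaves \<open>n \<le> relation_rank E\<close>.\<close>
    have "card F + n \<le> card E"
      by (rule prime_chain_length_bound[of E n c "card F"])
         (use c(2,3) in \<open>simp_all add: assms c(4) hilbert_ge_toric_ideal[OF F(1) assms F(3)]\<close>)
    then show "x \<le> enat (relation_rank E)" using F(2) c(1) by simp
  qed
  moreover have "ideal_height (poly_ring E) ?I \<le> prime_height (poly_ring E) ?I"
    unfolding ideal_height_def by (rule Inf_lower) (use prime in blast)
  ultimately show "ideal_height (poly_ring E) ?I \<le> enat (relation_rank E)" by (rule order_trans[rotated])
  show "enat (relation_rank E) \<le> ideal_height (poly_ring E) ?I"
    unfolding ideal_height_def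
    by (rule Inf_greatest) (auto intro: relation_rank_le_prime_height[OF assms])
qed

section \<open>Minimal binomial generators\<close>

text \<open>Used with two predicates: for a fibre of \<open>edge_monomial_image\<close> it extracts
  a graded component, and for the monomials of an induced subgraph it sets the remaining edges to
  zero.\<close>

definition restr :: "('m \<Rightarrow> bool) \<Rightarrow> ('m \<Rightarrow>\<^sub>0 'k::field) \<Rightarrow> ('m \<Rightarrow>\<^sub>0 'k)" where
  "restr P p = Poly_Mapping.mapp (\<lambda>m c. if P m then c else 0) p"

lemma lookup_restr: "lookup (restr P p) m = (if P m then lookup p m else 0)"
  by (auto simp: restr_def lookup_mapp when_def in_keys_iff)

interpretation restr: Vector_Spaces.linear "pscale :: 'k::field \<Rightarrow> ('a \<Rightarrow>\<^sub>0 'k) \<Rightarrow> _"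
    "pscale :: 'k::field \<Rightarrow> ('a \<Rightarrow>\<^sub>0 'k) \<Rightarrow> _" "restr P" for P
  by unfold_locales (auto intro!: poly_mapping_eqI simp: lookup_restr lookup_add)

lemma restr_binom:
  assumes "P u \<longleftrightarrow> P v"
  shows "restr P (binom u v) = (if P u then binom u v else 0)"
  using assms
  by (auto intro!: poly_mapping_eqI simp: lookup_restr binom_def lookup_minus lookup_single when_def)

lemma monomial_multiples_binomE:
  assumes "x \<in> monomial_multiples E (pair_binom ` B)" "B \<subseteq> image_pairs E"
  obtains w u v where "x = single w 1 * binom u v" "x = binom (w + u) (w + v)"
    "w \<in> monomials E" "(u, v) \<in> B" "(u, v) \<in> image_pairs E" "(w + u, w + v) \<in> image_pairs E"
proof -
  obtain w u v where "x = single w 1 * binom u v" "w \<in> monomials E" "(u, v) \<in> B"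
    using assms(1) by (auto simp: monomial_multiples_def)
  moreover from this have "(u, v) \<in> image_pairs E" "(w + u, w + v) \<in> image_pairs E"
    using assms(2) by (auto simp: image_pairs_def edge_monomial_image_add)
  ultimately show thesis using that single_mult_binom by metis
qed

lemma span_monomial_multiples_subset_toric_ideal:
  assumes "B \<subseteq> image_pairs E"
  shows "pm.span (monomial_multiples E (pair_binom ` B)) \<subseteq> toric_ideal E"
  unfolding toric_ideal_eq_span
proof (rule pm.span_minimal[OF _ pm.subspace_span], rule subsetI)
  fix x :: "_ \<Rightarrow>\<^sub>0 'b" assume "x \<in> monomial_multiples E (pair_binom ` B)"
  then obtain w u v where "x = binom (w + u) (w + v)" "(w + u, w + v) \<in> image_pairs E"
    by (rule monomial_multiples_binomE[OF _ assms])
  then show "x \<in> pm.span (pair_binom ` image_pairs E)" by (intro pm.span_base) force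
qed

text \<open>A graded Nakayama argument: among the binomials choose some that form a basis of the ideal
  modulo its product with the irrelevant ideal; they generate, by induction on the degree.\<close>

lemma binomial_generators:
  fixes F :: "(('v set \<Rightarrow>\<^sub>0 nat) \<Rightarrow>\<^sub>0 'k::field) set"
  assumes edges: "\<And>e. e \<in> E \<Longrightarrow> finite e \<and> e \<noteq> {}"
    and F: "finite F" "pm.span (monomial_multiples E F) = toric_ideal E" "F \<subseteq> toric_ideal E"
  obtains B where "B \<subseteq> image_pairs E" "finite B" "card B \<le> card F"
    "pm.span (monomial_multiples E (pair_binom ` B)) = (toric_ideal E :: (_ \<Rightarrow>\<^sub>0 'k) set)"
proof -
  \<comment> \<open>The span of \<open>N\<close> is the product of the irrelevant ideal with the
    toric ideal; the condition \<open>w \<noteq> 0\<close> encodes the positive degree of the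
    multiplier.\<close>
  define N :: "(('v set \<Rightarrow>\<^sub>0 nat) \<Rightarrow>\<^sub>0 'k) set" where
    "N = {binom (w + u) (w + v) | w u v. w \<in> monomials E \<and> w \<noteq> 0 \<and> (u, v) \<in> image_pairs E}"
  let ?S = "pair_binom ` image_pairs E :: (_ \<Rightarrow>\<^sub>0 'k) set"
  have mult_N: "single w 1 * f \<in> pm.span N"
    if w: "w \<in> monomials E" "w \<noteq> 0" and f: "f \<in> toric_ideal E" for w f
    using f unfolding toric_ideal_eq_span
  proof (induction rule: pm.span_induct_alt)
    case base then show ?case by (simp add: pm.span_zero)
  next
    case (step c x y)
    then obtain u v where "x = binom u v" "(u, v) \<in> image_pairs E" by auto
    then have "single w 1 * x \<in> N" using w by (auto simp: N_def single_mult_binom)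
    then show ?case using step(2)
      by (simp add: distrib_left mult_pscale_right pm.span_add pm.span_scale pm.span_base)
  qed
  have "monomial_multiples E F \<subseteq> pm.span (F \<union> N)"
  proof
    fix x assume "x \<in> monomial_multiples E F"
    then obtain w f where x: "x = single w 1 * f" "w \<in> monomials E" "f \<in> F"
      by (auto simp: monomial_multiples_def)
    show "x \<in> pm.span (F \<union> N)"
    proof (cases "w = 0")
      case True then show ?thesis using x by (simp add: pm.span_base)
    next
      case False
      then show ?thesis using mult_N[OF x(2)] x F(3) pm.span_mono[of N "F \<union> N"] by auto
    qed
  qed
  then have "toric_ideal E \<subseteq> pm.span (F \<union> N)"
    unfolding F(2)[symmetric] by (rule pm.span_minimal) simp
  then have "?S \<subseteq> pm.span (F \<union> N)"
    unfolding toric_ideal_eq_span using pm.span_superset by blast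
  then obtain B0 where B0: "B0 \<subseteq> ?S" "finite B0" "card B0 \<le> card F" "?S \<subseteq> pm.span (B0 \<union> N)"
    by (rule relative_spanning_subset[OF F(1)])
  obtain B where B: "B \<subseteq> image_pairs E" "inj_on (pair_binom :: _ \<Rightarrow> (_ \<Rightarrow>\<^sub>0 'k)) B" "B0 = pair_binom ` B"
    using B0(1) by (auto simp: subset_image_inj)
  let ?J = "pm.span (monomial_multiples E B0)"
  have gen: "binom u v \<in> ?J" if "(u, v) \<in> image_pairs E" for u v
    using that
  proof (induction "tdeg (edge_monomial_image u)" arbitrary: u v rule: less_induct)
    case less
    \<comment> \<open>A representation of \<open>binom u v\<close> over \<open>B0 \<union> N\<close>
      may mix degrees. Projecting to the component with the image of \<open>u\<close> fixes
      \<open>binom u v\<close> and leaves only terms of that same image, so that in a surviving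
      \<open>w * binom u' v'\<close> the second factor has smaller degree.\<close>
    let ?P = "\<lambda>m. edge_monomial_image m = edge_monomial_image u"
    have "binom u v \<in> pm.span (B0 \<union> N)" using less.prems B0(4) by force
    then have r1: "restr ?P (binom u v) \<in> pm.span (restr ?P ` (B0 \<union> N))"
      unfolding restr.span_image by (rule imageI)
    have r2: "restr ?P (binom u v) = (binom u v :: _ \<Rightarrow>\<^sub>0 'k)"
      using less.prems by (subst restr_binom) (auto simp: image_pairs_def)
    have "restr ?P ` (B0 \<union> N) \<subseteq> ?J"
    proof (rule image_subsetI)
      fix b assume "b \<in> B0 \<union> N"
      then show "restr ?P b \<in> ?J"
      proof
        assume b: "b \<in> B0"
        then obtain u' v' where uv': "b = binom u' v'" "(u', v') \<in> image_pairs E"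
          using B0(1) by force
        then have "restr ?P b = b \<or> restr ?P b = 0"
          by (simp add: restr_binom image_pairs_def)
        moreover have "single 0 1 * b \<in> monomial_multiples E B0"
          unfolding monomial_multiples_def using b zero_in_monomials by blast
        ultimately show ?thesis by (auto simp: pm.span_zero pm.span_base)
      next
        assume "b \<in> N"
        then obtain w u' v' where b: "b = binom (w + u') (w + v')" "w \<in> monomials E" "w \<noteq> 0"
          "(u', v') \<in> image_pairs E" unfolding N_def by blast
        show ?thesis
        proof (cases "?P (w + u')")
          case False
          then show ?thesis using b by (simp add: restr_binom image_pairs_def edge_monomial_image_add pm.span_zero)
        next
          case True
          have "keys (edge_monomial_image w) = \<Union>(keys w)"
            using b(2) edges by (intro keys_edge_monomial_image) (auto simp: monomials_def)
          moreover have "\<Union>(keys w) \<noteq> {}"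
            using b(2,3) edges by (force simp: monomials_def simp flip: keys_eq_empty)
          \<comment> \<open>This is where nonempty edges enter: the grading is positive, so the
            induction descends.\<close>
          ultimately have "edge_monomial_image w \<noteq> 0" by auto
          then have "0 < tdeg (edge_monomial_image w)" by (metis tdeg_eq_0_iff gr0I)
          then have "tdeg (edge_monomial_image u') < tdeg (edge_monomial_image u)"
            using arg_cong[OF True, of tdeg] by (simp add: edge_monomial_image_add tdeg_add)
          then have "binom u' v' \<in> ?J" using less.hyps b(4) by blast
          then have "single w 1 * binom u' v' \<in> ?J"
            by (rule mult_in_span_monomial_multiples[OF single_in_carrier[OF b(2)]])
          then have "b \<in> ?J" by (simp add: b(1) single_mult_binom)
          moreover have "restr ?P b = b"
            using True b by (simp add: restr_binom image_pairs_def edge_monomial_image_add)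
          ultimately show ?thesis by simp
        qed
      qed
    qed
    then have "pm.span (restr ?P ` (B0 \<union> N)) \<subseteq> ?J" by (rule pm.span_minimal) simp
    then show ?case using r1 unfolding r2 by (rule subsetD)
  qed
  have "toric_ideal E \<subseteq> ?J"
    unfolding toric_ideal_eq_span by (rule pm.span_minimal) (use gen in auto)
  then have "pm.span (monomial_multiples E (pair_binom ` B)) = (toric_ideal E :: (_ \<Rightarrow>\<^sub>0 'k) set)"
    using span_monomial_multiples_subset_toric_ideal[OF B(1)] B(3) by blast
  moreover have "finite B" "card B \<le> card F"
    using B0(2,3) B(3) card_image[OF B(2)] finite_image_iff[OF B(2)] by auto
  ultimately show thesis using that B(1) by blast
qed

text \<open>A monomial multiple of a binomial has the same exponent difference, so the generated
  ideal stays inside the lattice ideal of the span of the vectors of \<open>B\<close>. Every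
  binomial of the toric ideal then lies there, and its vector can be read off.\<close>

lemma pair_relation_span_of_generators:
  assumes "B \<subseteq> image_pairs E"
    and "pm.span (monomial_multiples E (pair_binom ` B)) = (toric_ideal E :: (_ \<Rightarrow>\<^sub>0 'k::field) set)"
  shows "pair_relation ` image_pairs E \<subseteq> pm.span (pair_relation ` B)"
proof -
  let ?L = "pm.span (pair_relation ` B)"
  have "monomial_multiples E (pair_binom ` B) \<subseteq> (lattice_ideal E ?L :: (_ \<Rightarrow>\<^sub>0 'k) set)"
  proof
    fix x :: "_ \<Rightarrow>\<^sub>0 'k" assume "x \<in> monomial_multiples E (pair_binom ` B)"
    then obtain w u v where x: "x = binom (w + u) (w + v)" "(u, v) \<in> B" "(w + u, w + v) \<in> image_pairs E"
      by (rule monomial_multiples_binomE[OF _ assms(1)])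
    have "vec (w + u) - vec (w + v) = pair_relation (u, v)" by (simp add: vec_add)
    also have "\<dots> \<in> ?L" using x(2) by (intro pm.span_base imageI)
    finally show "x \<in> lattice_ideal E ?L"
      unfolding x(1) using x(3) by (subst binom_in_lattice_ideal_iff) (auto simp: image_pairs_def)
  qed
  then have sub: "toric_ideal E \<subseteq> (lattice_ideal E ?L :: (_ \<Rightarrow>\<^sub>0 'k) set)"
    unfolding assms(2)[symmetric]
    by (rule pm.span_minimal) (simp add: lattice_ideal_def)
  show ?thesis
  proof (rule image_subsetI)
    fix q assume q: "q \<in> image_pairs E"
    then obtain u v where uv: "q = (u, v)" "u \<in> monomials E" "v \<in> monomials E"
      by (auto simp: image_pairs_def)
    have "(pair_binom q :: _ \<Rightarrow>\<^sub>0 'k) \<in> toric_ideal E"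
      unfolding toric_ideal_eq_span using q by (intro pm.span_base imageI)
    then have "(binom u v :: _ \<Rightarrow>\<^sub>0 'k) \<in> lattice_ideal E ?L" using sub uv(1) by auto
    then show "pair_relation q \<in> ?L" using uv by (simp add: binom_in_lattice_ideal_iff)
  qed
qed

lemma relation_rank_le_card_generators:
  assumes "finite E" "B \<subseteq> image_pairs E" "finite B"
    and "pm.span (monomial_multiples E (pair_binom ` B)) = (toric_ideal E :: (_ \<Rightarrow>\<^sub>0 'k::field) set)"
  shows "relation_rank E \<le> card (pair_relation ` B)"
proof -
  have "pm.dim (pair_relation ` image_pairs E) \<le> card (pair_relation ` B)"
    by (rule pm.dim_le_card[OF pair_relation_span_of_generators[OF assms(2,4)]])
       (use assms(3) in simp)
  then show ?thesis by (simp add: relation_rank_def)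
qed

section \<open>Induced subgraphs\<close>

lemma monomials_induced_edges_iff:
  assumes "\<And>e. e \<in> E \<Longrightarrow> finite e"
  shows "m \<in> monomials (induced_edges E H) \<longleftrightarrow>
    m \<in> monomials E \<and> keys (edge_monomial_image m) \<subseteq> H"
proof -
  have "keys (edge_monomial_image m) = \<Union>(keys m)" if "m \<in> monomials E"
    using that assms by (intro keys_edge_monomial_image) (auto simp: monomials_def)
  then show ?thesis by (auto simp: monomials_def induced_edges_def)
qed

text \<open>Setting the edges outside \<open>H\<close> to zero either fixes or kills a binomial of the toric ideal,
  because the image monomial determines whether all edges lie in \<open>H\<close>.\<close>

lemma induced_generators:
  assumes edges: "\<And>e. e \<in> E \<Longrightarrow> finite e" and "B \<subseteq> image_pairs E"
    and gen: "pm.span (monomial_multiples E (pair_binom ` B)) = (toric_ideal E :: (_ \<Rightarrow>\<^sub>0 'k::field) set)"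
    and EH: "EH = induced_edges E H"
  shows "pm.span (monomial_multiples EH (pair_binom ` (B \<inter> image_pairs EH))) =
    (toric_ideal EH :: (_ \<Rightarrow>\<^sub>0 'k) set)"
proof
  let ?B = "B \<inter> image_pairs EH"
  let ?J = "pm.span (monomial_multiples EH (pair_binom ` ?B)) :: (_ \<Rightarrow>\<^sub>0 'k) set"
  let ?P = "\<lambda>m. m \<in> monomials EH"
  show "?J \<subseteq> toric_ideal EH" by (rule span_monomial_multiples_subset_toric_ideal) simp
  have iff: "u \<in> monomials EH \<longleftrightarrow> v \<in> monomials EH" if "(u, v) \<in> image_pairs E" for u v
    using that by (auto simp: EH image_pairs_def monomials_induced_edges_iff[OF edges])
  have sub: "image_pairs EH \<subseteq> image_pairs E"
    by (auto simp: EH image_pairs_def monomials_induced_edges_iff[OF edges])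
  have restr_J: "restr ?P ` monomial_multiples E (pair_binom ` B) \<subseteq> ?J"
  proof (rule image_subsetI)
    fix x :: "_ \<Rightarrow>\<^sub>0 'k" assume "x \<in> monomial_multiples E (pair_binom ` B)"
    then obtain w u v where x: "x = single w 1 * binom u v" "x = binom (w + u) (w + v)"
      "w \<in> monomials E" "(u, v) \<in> B" "(u, v) \<in> image_pairs E" "(w + u, w + v) \<in> image_pairs E"
      by (rule monomial_multiples_binomE[OF _ assms(2)])
    have eq: "restr ?P x = (if ?P (w + u) then x else 0)"
      unfolding x(2) by (rule restr_binom) (rule iff[OF x(6)])
    show "restr ?P x \<in> ?J"
    proof (cases "?P (w + u)")
      case False then show ?thesis unfolding eq by (simp only: if_False pm.span_zero)
    next
      case True
      \<comment> \<open>A product of monomials uses only edges of the subgraph exactly when both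
        factors do, so a surviving multiple arises from a surviving generator with a multiplier from
        the smaller ring.\<close>
      then have wu: "w \<in> monomials EH" "u \<in> monomials EH" by simp_all
      then have "(u, v) \<in> image_pairs EH" using x(5) iff[OF x(5)] by (simp add: image_pairs_def)
      then have "x \<in> monomial_multiples EH (pair_binom ` ?B)"
        unfolding monomial_multiples_def x(1) using wu(1) x(4) by force
      then show ?thesis using True by (simp add: eq pm.span_base)
    qed
  qed
  show "toric_ideal EH \<subseteq> ?J"
    unfolding toric_ideal_eq_span
  proof (rule pm.span_minimal[OF _ pm.subspace_span], rule image_subsetI)
    fix q assume q: "q \<in> image_pairs EH"
    obtain u v where uv: "q = (u, v)" by fastforce
    have "(pair_binom q :: _ \<Rightarrow>\<^sub>0 'k) \<in> pm.span (monomial_multiples E (pair_binom ` B))"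
      unfolding gen toric_ideal_eq_span using q sub by (intro pm.span_base imageI) blast
    then have "restr ?P (pair_binom q :: _ \<Rightarrow>\<^sub>0 'k) \<in> pm.span (restr ?P ` monomial_multiples E (pair_binom ` B))"
      unfolding restr.span_image by (rule imageI)
    moreover have "pm.span (restr ?P ` monomial_multiples E (pair_binom ` B)) \<subseteq> ?J"
      using restr_J by (rule pm.span_minimal) simp
    moreover have "restr ?P (pair_binom q) = (pair_binom q :: _ \<Rightarrow>\<^sub>0 'k)"
      using q by (auto simp: uv restr_binom image_pairs_def)
    ultimately show "pair_binom q \<in> ?J" by auto
  qed
qed

lemma induced_generators_card:
  assumes edges: "\<And>e. e \<in> E \<Longrightarrow> finite e" and "finite E" "B \<subseteq> image_pairs E" "finite B"
    and gen: "pm.span (monomial_multiples E (pair_binom ` B)) = (toric_ideal E :: (_ \<Rightarrow>\<^sub>0 'k::field) set)"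
    and card: "card B \<le> relation_rank E" and EH: "EH = induced_edges E H"
  shows "card (B \<inter> image_pairs EH) = relation_rank EH"
proof (rule antisym)
  let ?B = "B \<inter> image_pairs EH"
  have finEH: "finite EH" using assms(2) by (simp add: EH induced_edges_def)
  have le: "relation_rank E \<le> card (pair_relation ` B)"
    by (rule relation_rank_le_card_generators[OF assms(2-4) gen])
  have le': "card (pair_relation ` B) \<le> card B" by (rule card_image_le[OF assms(4)])
  have inj: "inj_on pair_relation B"
    by (rule eq_card_imp_inj_on[OF assms(4)]) (use le le' card in simp)
  obtain C where C: "C \<subseteq> pair_relation ` image_pairs E" "pm.independent C" "card C = relation_rank E"
    by (rule relation_basis[OF assms(2)])
  have "pm.independent (pair_relation ` B)"
  proof (rule independent_of_card_le_dim)
    show "C \<subseteq> pm.span (pair_relation ` B)"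
      using C(1) pair_relation_span_of_generators[OF assms(3) gen] by blast
    show "card (pair_relation ` B) \<le> card C" using le' card C(3) by simp
  qed (use assms(4) C(2) in auto)
  then have ind: "pm.independent (pair_relation ` ?B)" by (rule pm.independent_mono) blast
  obtain D where D: "finite D" "pm.span D = pm.span (pair_relation ` image_pairs EH)"
      "card D = relation_rank EH"
    by (rule relation_basis[OF finEH])
  have "pair_relation ` ?B \<subseteq> pm.span D"
    unfolding D(2) using pm.span_superset by blast
  then have "card (pair_relation ` ?B) \<le> relation_rank EH"
    using pm.independent_span_bound[OF D(1) ind] D(3) by simp
  then show "card ?B \<le> relation_rank EH"
    using card_image[OF inj_on_subset[OF inj], of ?B] by simp
  have "relation_rank EH \<le> card (pair_relation ` ?B)"
    by (rule relation_rank_le_card_generators[OF finEH _ _ induced_generators[OF edges assms(3) gen EH]])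
       (use assms(4) in auto)
  also have "\<dots> \<le> card ?B" by (rule card_image_le) (use assms(4) in simp)
  finally show "relation_rank EH \<le> card ?B" .
qed

lemma complete_intersection_induced:
  fixes E :: "'v set set"
  assumes "finite E" and edges: "\<And>e. e \<in> E \<Longrightarrow> finite e \<and> e \<noteq> {}"
    and CI: "complete_intersection TYPE('k::field) V E"
  shows "complete_intersection TYPE('k) H (induced_edges E H)"
proof -
  define EH where "EH = induced_edges E H"
  have finEH: "finite EH" using assms(1) by (simp add: EH_def induced_edges_def)
  obtain fs :: "(('v set \<Rightarrow>\<^sub>0 nat) \<Rightarrow>\<^sub>0 'k) list" where fs:
    "length fs = relation_rank E" "set fs \<subseteq> carrier (poly_ring E)"
    "genideal (poly_ring E) (set fs) = toric_ideal E"
    using CI ideal_height_toric_ideal[OF assms(1), where 'k = 'k]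
    by (auto simp: complete_intersection_def)
  interpret R: cring "poly_ring E :: (_ \<Rightarrow>\<^sub>0 'k) ring" by (rule cring_poly_ring)
  have span: "pm.span (monomial_multiples E (set fs)) = toric_ideal E"
    using fs(3) by (simp add: genideal_eq_span[OF fs(2)])
  have sub: "set fs \<subseteq> toric_ideal E"
    using R.genideal_self[OF fs(2)] fs(3) by simp
  obtain B where B: "B \<subseteq> image_pairs E" "finite B" "card B \<le> card (set fs)"
    "pm.span (monomial_multiples E (pair_binom ` B)) = (toric_ideal E :: (_ \<Rightarrow>\<^sub>0 'k) set)"
    by (rule binomial_generators[OF edges finite_set span sub])
  \<comment> \<open>Repetitions in \<open>fs\<close> are harmless, since only the upper bound
    \<open>card (set fs) \<le> length fs\<close> enters; equality with the rank is recovered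
    afterwards.\<close>
  have card: "card B \<le> relation_rank E" using B(3) card_length[of fs] fs(1) by simp
  let ?B = "B \<inter> image_pairs EH"
  have gen: "pm.span (monomial_multiples EH (pair_binom ` ?B)) = (toric_ideal EH :: (_ \<Rightarrow>\<^sub>0 'k) set)"
    using edges by (intro induced_generators[OF _ B(1,4) EH_def]) blast
  have "card ?B = relation_rank EH"
    using edges by (intro induced_generators_card[OF _ assms(1) B(1,2,4) card EH_def]) blast
  moreover obtain ps where ps: "set ps = ?B" "distinct ps"
    using finite_distinct_list[of ?B] B(2) by auto
  ultimately have len: "length ps = relation_rank EH" by (metis distinct_card)
  have carrier: "pair_binom ` ?B \<subseteq> carrier (poly_ring EH :: (_ \<Rightarrow>\<^sub>0 'k) ring)"
    using keys_binom_subset by (fastforce simp: carrier_poly_ring image_pairs_def)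
  show ?thesis
    unfolding complete_intersection_def EH_def[symmetric]
  proof (intro exI[of _ "map pair_binom ps"] conjI)
    show "genideal (poly_ring EH) (set (map pair_binom ps)) = (toric_ideal EH :: (_ \<Rightarrow>\<^sub>0 'k) set)"
      using gen by (simp add: ps(1) genideal_eq_span[OF carrier])
  qed (use carrier len in \<open>simp_all add: ps(1) ideal_height_toric_ideal[OF finEH]\<close>)
qed

theorem theorem3p1:
  fixes V :: "'v set" and E :: "'v set set"
  assumes "simple_graph V E" and "connected_graph V E"
  shows "complete_intersection TYPE('k::field) V E \<longleftrightarrow>
         (\<forall>H\<subseteq>V. complete_intersection TYPE('k) H (induced_edges E H))"
proof
  have V: "finite V" and E: "\<And>e. e \<in> E \<Longrightarrow> e \<subseteq> V \<and> card e = 2"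
    using assms(1) by (auto simp: simple_graph_def)
  have "finite E" using V E by (intro finite_subset[of E "Pow V"]) auto
  moreover have "finite e \<and> e \<noteq> {}" if "e \<in> E" for e
    using E[OF that] by (auto intro: card_ge_0_finite)
  moreover assume "complete_intersection TYPE('k) V E"
  ultimately show "\<forall>H\<subseteq>V. complete_intersection TYPE('k) H (induced_edges E H)"
    by (blast intro: complete_intersection_induced)
next
  assume "\<forall>H\<subseteq>V. complete_intersection TYPE('k) H (induced_edges E H)"
  then have "complete_intersection TYPE('k) V (induced_edges E V)" by blast
  moreover have "induced_edges E V = E"
    using assms(1) by (auto simp: simple_graph_def induced_edges_def)
  ultimately show "complete_intersection TYPE('k) V E" by simp
qed

end
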